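(* For any constant $c>\frac{5}{6}$, every instance of the roommates model with strict, possibly incomplete preferences and $n$ agents admits a $cn$-stable matching, and such a matching can be found in polynomial time.
   Context: Roommates model: a set $N$ of $n$ agents; each agent $i$ has a strict linear order $\succ_i$ over a subset of $N\setminus\{i\}$ (its acceptable agents), acceptability being mutual. A matching is a set of disjoint pairs $\{i,j\}$ of mutually acceptable agents; $M(i)$ is the partner of $i$ (possibly none), and being matched to any acceptable agent is strictly better than being unmatched. For a real number $k$, a matching $M$ is $k$-stable if there is no matching $M'$ with $|\{i\in N: M'(i)\succ_i M(i)\}|\ge k$. *)

theory Defs
  imports
    Complex_Main
    "HOL-Library.Disjoint_Sets"
    "HOL-Computational_Algebra.Polynomial"
begin

section \<open>Roommates instances and matchings\<close>

text \<open>\<open>A i\<close> is the set of agents acceptable to \<open>i\<close>, and \<open>(x, y) \<in> P i\<close> reads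
  \<open>x \<succ>\<^sub>i y\<close>, i.e. \<open>i\<close> strictly prefers \<open>x\<close> to \<open>y\<close>.\<close>

definition roommates :: "'a set \<Rightarrow> ('a \<Rightarrow> 'a set) \<Rightarrow> ('a \<Rightarrow> ('a \<times> 'a) set) \<Rightarrow> bool" where
  "roommates N A P \<longleftrightarrow>
     finite N \<and>
     (\<forall>i\<in>N. A i \<subseteq> N - {i}) \<and>
     (\<forall>i\<in>N. \<forall>j\<in>N. j \<in> A i \<longleftrightarrow> i \<in> A j) \<and>
     (\<forall>i\<in>N. P i \<subseteq> A i \<times> A i \<and> strict_linear_order_on (A i) (P i))"

definition matching :: "'a set \<Rightarrow> ('a \<Rightarrow> 'a set) \<Rightarrow> 'a set set \<Rightarrow> bool" where
  "matching N A M \<longleftrightarrow>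
     (\<forall>e\<in>M. \<exists>i\<in>N. \<exists>j\<in>N. j \<in> A i \<and> i \<in> A j \<and> e = {i, j}) \<and> disjoint M"

definition partner :: "'a set set \<Rightarrow> 'a \<Rightarrow> 'a option" where
  "partner M i = (if \<exists>j. {i, j} \<in> M then Some (THE j. {i, j} \<in> M) else None)"

text \<open>The preferences of agent \<open>i\<close> over outcomes, where \<open>None\<close> means being unmatched.\<close>

fun better :: "('a \<Rightarrow> 'a set) \<Rightarrow> ('a \<Rightarrow> ('a \<times> 'a) set) \<Rightarrow> 'a \<Rightarrow> 'a option \<Rightarrow> 'a option \<Rightarrow> bool" where
  "better A P i (Some x) (Some y) \<longleftrightarrow> (x, y) \<in> P i"
| "better A P i (Some x) None \<longleftrightarrow> x \<in> A i"
| "better A P i None _ \<longleftrightarrow> False"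

definition k_stable ::
  "'a set \<Rightarrow> ('a \<Rightarrow> 'a set) \<Rightarrow> ('a \<Rightarrow> ('a \<times> 'a) set) \<Rightarrow> real \<Rightarrow> 'a set set \<Rightarrow> bool" where
  "k_stable N A P k M \<longleftrightarrow>
     matching N A M \<and>
     \<not> (\<exists>M'. matching N A M' \<and>
            real (card {i\<in>N. better A P i (partner M' i) (partner M i)}) \<ge> k)"


section \<open>Model of computation\<close>

text \<open>Running time is measured in Jones's WHILE language (N. D. Jones, Computability and
  Complexity from a Programming Perspective, MIT Press, 1997): imperative programs over binary
  trees, with every expression node and every executed test or assignment costing one unit.
  The only operations are those a pointer machine performs in constant time (allocating a cell,
  following a pointer, testing for the empty tree), so polynomial time in this model coincides
  with polynomial time on Turing machines and random access machines.\<close>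

datatype tree = Leaf | Fork tree tree

datatype expr =
    Var nat
  | Empty
  | Node expr expr
  | Hd expr
  | Tl expr

datatype prog =
    Skip
  | Assign nat expr
  | Seq prog prog
  | If expr prog prog
  | While expr prog

type_synonym store = "nat \<Rightarrow> tree"

fun left :: "tree \<Rightarrow> tree" where
  "left Leaf = Leaf"
| "left (Fork l r) = l"

fun right :: "tree \<Rightarrow> tree" where
  "right Leaf = Leaf"
| "right (Fork l r) = r"

fun expr_val :: "expr \<Rightarrow> store \<Rightarrow> tree" where
  "expr_val (Var x) s = s x"
| "expr_val Empty s = Leaf"
| "expr_val (Node a b) s = Fork (expr_val a s) (expr_val b s)"
| "expr_val (Hd a) s = left (expr_val a s)"
| "expr_val (Tl a) s = right (expr_val a s)"

fun expr_cost :: "expr \<Rightarrow> nat" where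
  "expr_cost (Var x) = 1"
| "expr_cost Empty = 1"
| "expr_cost (Node a b) = expr_cost a + expr_cost b + 1"
| "expr_cost (Hd a) = expr_cost a + 1"
| "expr_cost (Tl a) = expr_cost a + 1"

text \<open>\<open>run p s t s'\<close>: started in store \<open>s\<close>, the program \<open>p\<close> halts in store \<open>s'\<close> after exactly
  \<open>t\<close> time units. In tests, \<open>Leaf\<close> is false and every other tree is true.\<close>

inductive run :: "prog \<Rightarrow> store \<Rightarrow> nat \<Rightarrow> store \<Rightarrow> bool" where
  run_Skip: "run Skip s 1 s"
| run_Assign: "run (Assign x e) s (expr_cost e + 1) (s(x := expr_val e s))"
| run_Seq: "run p s t s' \<Longrightarrow> run q s' u s'' \<Longrightarrow> run (Seq p q) s (t + u) s''"
| run_IfTrue: "expr_val e s \<noteq> Leaf \<Longrightarrow> run p s t s' \<Longrightarrow> run (If e p q) s (expr_cost e + 1 + t) s'"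
| run_IfFalse: "expr_val e s = Leaf \<Longrightarrow> run q s t s' \<Longrightarrow> run (If e p q) s (expr_cost e + 1 + t) s'"
| run_WhileFalse: "expr_val e s = Leaf \<Longrightarrow> run (While e p) s (expr_cost e + 1) s"
| run_WhileTrue: "expr_val e s \<noteq> Leaf \<Longrightarrow> run p s t s' \<Longrightarrow> run (While e p) s' u s'' \<Longrightarrow>
    run (While e p) s (expr_cost e + 1 + t + u) s''"

inductive_cases SkipE: "run Skip s t s'"
inductive_cases AssignE: "run (Assign x e) s t s'"
inductive_cases SeqE: "run (Seq p q) s t s'"
inductive_cases IfE: "run (If e p q) s t s'"
inductive_cases WhileE: "run (While e p) s t s'"

lemma run_deterministic:
  "run p s t s' \<Longrightarrow> run p s u s'' \<Longrightarrow> t = u \<and> s' = s''"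
proof (induction arbitrary: u s'' rule: run.induct)
  case (run_Seq p s t s' q v s2)
  from run_Seq.prems show ?case
    by (rule SeqE) (auto dest!: run_Seq.IH)
next
  case (run_IfTrue e s p t s' q)
  from run_IfTrue.prems show ?case
    by (rule IfE) (auto simp: run_IfTrue.hyps(1) dest!: run_IfTrue.IH)
next
  case (run_IfFalse e s q t s' p)
  from run_IfFalse.prems show ?case
    by (rule IfE) (auto simp: run_IfFalse.hyps(1) dest!: run_IfFalse.IH)
next
  case (run_WhileFalse e s p)
  from run_WhileFalse.prems show ?case
    by (rule WhileE) (auto simp: run_WhileFalse.hyps)
next
  case (run_WhileTrue e s p t s' v s2)
  from run_WhileTrue.prems show ?case
    by (rule WhileE) (auto simp: run_WhileTrue.hyps(1) dest!: run_WhileTrue.IH)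
qed (auto elim: SkipE AssignE)

text \<open>Input and output are passed in variable 0; all other variables are initially empty.\<close>

definition computes_within :: "prog \<Rightarrow> tree \<Rightarrow> nat \<Rightarrow> tree \<Rightarrow> bool" where
  "computes_within p x T y \<longleftrightarrow>
     (\<exists>t s. run p ((\<lambda>_. Leaf)(0 := x)) t s \<and> t \<le> T \<and> s 0 = y)"


section \<open>Encoding of instances and matchings\<close>

text \<open>Numbers are written in unary. An instance contains one preference list per agent, so its
  size is at least \<open>n\<close> in any such encoding, and at most cubic in \<open>n\<close> in this one; hence polynomial
  in \<open>n\<close>, polynomial in the size of this encoding and polynomial in the size of the binary encoding
  all mean the same.\<close>

fun enc_nat :: "nat \<Rightarrow> tree" where
  "enc_nat 0 = Leaf"
| "enc_nat (Suc n) = Fork Leaf (enc_nat n)"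

fun enc_list :: "('b \<Rightarrow> tree) \<Rightarrow> 'b list \<Rightarrow> tree" where
  "enc_list f [] = Leaf"
| "enc_list f (x # xs) = Fork (f x) (enc_list f xs)"

fun enc_option :: "('b \<Rightarrow> tree) \<Rightarrow> 'b option \<Rightarrow> tree" where
  "enc_option f None = Leaf"
| "enc_option f (Some x) = Fork Leaf (f x)"

text \<open>The acceptable agents of \<open>i\<close>, listed from best to worst.\<close>

definition pref_list :: "('a \<Rightarrow> 'a set) \<Rightarrow> ('a \<Rightarrow> ('a \<times> 'a) set) \<Rightarrow> 'a \<Rightarrow> 'a list" where
  "pref_list A P i = (THE xs. set xs = A i \<and> sorted_wrt (\<lambda>x y. (x, y) \<in> P i) xs)"

lemma sorted_wrt_unique:
  assumes "trans r" "irrefl r" "sorted_wrt (\<lambda>x y. (x, y) \<in> r) xs"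
    "sorted_wrt (\<lambda>x y. (x, y) \<in> r) ys" "set xs = set ys"
  shows "xs = ys"
  using assms(3-5)
proof (induction xs arbitrary: ys)
  case Nil
  then show ?case by simp
next
  case (Cons x xs)
  then obtain y zs where ys: "ys = y # zs" by (cases ys) auto
  have asym: "(a, b) \<in> r \<Longrightarrow> (b, a) \<notin> r" for a b
    using assms(1,2) by (meson irreflD transD)
  have "x \<in> set (y # zs)" "y \<in> set (x # xs)" using Cons.prems ys by auto
  then have "x = y" using Cons.prems ys asym by fastforce
  moreover have "x \<notin> set xs" "y \<notin> set zs"
    using Cons.prems ys assms(2) by (auto dest: irreflD)
  ultimately have "set xs = set zs" using Cons.prems(3) ys by auto
  then show ?case using Cons.IH[of zs] Cons.prems ys \<open>x = y\<close> by simp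
qed

lemma sorted_wrt_exists:
  assumes "finite B" "trans r" "irrefl r" "total_on B r"
  shows "\<exists>xs. set xs = B \<and> sorted_wrt (\<lambda>x y. (x, y) \<in> r) xs"
  using assms(1,4)
proof (induction B rule: finite_induct)
  case empty
  then show ?case by simp
next
  case (insert b B)
  then obtain xs where xs: "set xs = B" "sorted_wrt (\<lambda>x y. (x, y) \<in> r) xs"
    unfolding total_on_def by auto
  let ?l = "filter (\<lambda>x. (x, b) \<in> r) xs" and ?u = "filter (\<lambda>x. (b, x) \<in> r) xs"
  have "set (?l @ b # ?u) = insert b B"
    using insert.prems insert.hyps xs(1) unfolding total_on_def by auto
  moreover have "sorted_wrt (\<lambda>x y. (x, y) \<in> r) (?l @ b # ?u)"
    using xs(2) assms(2) by (auto simp: sorted_wrt_append sorted_wrt_filter dest: transD)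
  ultimately show ?case by blast
qed

lemma pref_list:
  assumes "roommates N A P" "i \<in> N"
  shows "set (pref_list A P i) = A i"
    and "sorted_wrt (\<lambda>x y. (x, y) \<in> P i) (pref_list A P i)"
proof -
  have "finite (A i)" "trans (P i)" "irrefl (P i)" "total_on (A i) (P i)"
    using assms unfolding roommates_def strict_linear_order_on_def
    by (auto dest: finite_subset)
  then have "\<exists>!xs. set xs = A i \<and> sorted_wrt (\<lambda>x y. (x, y) \<in> P i) xs"
    using sorted_wrt_exists[of "A i" "P i"] sorted_wrt_unique[of "P i"] by (intro ex_ex1I) auto
  from theI'[OF this] show "set (pref_list A P i) = A i"
    and "sorted_wrt (\<lambda>x y. (x, y) \<in> P i) (pref_list A P i)"
    unfolding pref_list_def by auto
qed

definition enc_instance :: "nat \<Rightarrow> (nat \<Rightarrow> nat set) \<Rightarrow> (nat \<Rightarrow> (nat \<times> nat) set) \<Rightarrow> tree" where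
  "enc_instance n A P = enc_list (enc_list enc_nat) (map (pref_list A P) [0..<n])"

definition enc_matching :: "nat \<Rightarrow> nat set set \<Rightarrow> tree" where
  "enc_matching n M = enc_list (enc_option enc_nat) (map (partner M) [0..<n])"

end

theory Submission
  imports Defs
begin

text \<open>Irving's algorithm, adapted to instances without a stable matching. Rejecting dominated pairs
  leads to a balanced table, in which \<open>j\<close> is first on the list of \<open>i\<close> iff \<open>i\<close> is last on the list
  of \<open>j\<close>. Cutting a first choice \<open>y\<close> off the list of \<open>x\<close> and rejecting again can empty no list but
  that of \<open>y\<close>, since every other agent keeps holding a proposal. If some list has three entries, then
  a suitable \<open>x\<close> on a rotation empties no list at all. Once all lists have at most two entries,
  whenever \<open>y\<close> loses its whole list, the table contains an odd cycle through \<open>y\<close>, and two of its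
  members become matched for good; hence at most \<open>n / 3\<close> agents lose their lists. Every pair that
  blocks the resulting matching contains one of them. So if \<open>I\<close> is the set of agents improving in
  another matching, at most \<open>2 n / 3\<close> of them are matched inside \<open>I\<close> and at most \<open>n - |I|\<close> to agents
  outside \<open>I\<close>, which gives \<open>|I| \<le> 5 n / 6\<close>.

  The suitable \<open>x\<close> is found by trying all agents, so the algorithm consists of bounded iterations over
  lists only, and its running time is bounded by closure properties of the class of
  polynomial-time functions.\<close>

section \<open>Tables and rejections\<close>

text \<open>Two mechanisms carry the argument. The first is domination: a pair disappears only when
  one of its ends holds a proposal that it prefers, and what an agent holds can only improve under
  further rejections. So a deleted pair cannot block later, unless an end that dominated it has lost
  its list. Only lists emptied by a cut cause this; an agent emptied by the initial proposals costs
  nothing, since the other ends dominate all its pairs. The second is a lower bound. Rotations are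
  never computed; they only prove that a harmless cut exists. Eliminating one yields a balanced
  table that dominates whatever it lacks, and no sequence of rejections after the corresponding cut
  can delete a pair of such a table. Hence trying a cut and undoing it when the list of
  \<open>y\<close> becomes empty is as good as knowing the rotation, and the order of the rejections
  does not matter.\<close>

locale ranking =
  fixes V :: "'a set" and E :: "('a \<times> 'a) set" and pr :: "'a \<Rightarrow> 'a \<Rightarrow> nat"
  assumes finite_V: "finite V" and E_sub: "E \<subseteq> V \<times> V"
    and E_sym: "(i, j) \<in> E \<Longrightarrow> (j, i) \<in> E" and E_irrefl: "(i, i) \<notin> E"
    and pr_inj: "(i, j) \<in> E \<Longrightarrow> (i, k) \<in> E \<Longrightarrow> pr i j = pr i k \<Longrightarrow> j = k"
begin

definition table :: "('a \<times> 'a) set \<Rightarrow> bool" where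
  "table T \<longleftrightarrow> T \<subseteq> E \<and> (\<forall>i j. (i, j) \<in> T \<longrightarrow> (j, i) \<in> T)"

definition best :: "('a \<times> 'a) set \<Rightarrow> 'a \<Rightarrow> 'a \<Rightarrow> bool" where
  "best T i j \<longleftrightarrow> (i, j) \<in> T \<and> (\<forall>k. (i, k) \<in> T \<longrightarrow> pr i j \<le> pr i k)"

definition worst :: "('a \<times> 'a) set \<Rightarrow> 'a \<Rightarrow> 'a \<Rightarrow> bool" where
  "worst T i j \<longleftrightarrow> (i, j) \<in> T \<and> (\<forall>k. (i, k) \<in> T \<longrightarrow> pr i k \<le> pr i j)"

definition cut :: "'a \<Rightarrow> 'a \<Rightarrow> ('a \<times> 'a) set \<Rightarrow> ('a \<times> 'a) set" where
  "cut j k T = T - {(j, k), (k, j)}"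

text \<open>If \<open>i\<close> proposes to its favourite \<open>j\<close>, then \<open>j\<close> may reject anyone it likes less than \<open>i\<close>.\<close>

definition rejection :: "('a \<times> 'a) set \<Rightarrow> ('a \<times> 'a) set \<Rightarrow> bool" where
  "rejection T T' \<longleftrightarrow> (\<exists>i j k. best T i j \<and> worst T j k \<and> k \<noteq> i \<and> T' = cut j k T)"

definition balanced :: "('a \<times> 'a) set \<Rightarrow> bool" where
  "balanced T \<longleftrightarrow> table T \<and> (\<forall>i j. best T i j \<longrightarrow> worst T j i)"

definition dominated :: "('a \<times> 'a) set \<Rightarrow> 'a \<Rightarrow> 'a \<Rightarrow> bool" where
  "dominated T j k \<longleftrightarrow> (\<exists>i. best T i j \<and> pr j i < pr j k)"

lemma tableD: "table T \<Longrightarrow> (i, j) \<in> T \<Longrightarrow> (j, i) \<in> T"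
  and table_E: "table T \<Longrightarrow> (i, j) \<in> T \<Longrightarrow> (i, j) \<in> E"
  by (auto simp: table_def)

lemma bestD: "best T i j \<Longrightarrow> (i, j) \<in> T" "best T i j \<Longrightarrow> (i, k) \<in> T \<Longrightarrow> pr i j \<le> pr i k"
  by (auto simp: best_def)

lemma worstD: "worst T i j \<Longrightarrow> (i, j) \<in> T" "worst T i j \<Longrightarrow> (i, k) \<in> T \<Longrightarrow> pr i k \<le> pr i j"
  by (auto simp: worst_def)

lemma table_cut: "table T \<Longrightarrow> table (cut j k T)"
  by (auto simp: table_def cut_def)

lemma best_unique: "table T \<Longrightarrow> best T i j \<Longrightarrow> best T i k \<Longrightarrow> j = k"
  using pr_inj[of i j k] by (simp add: best_def table_E le_antisym)

lemma worst_unique: "table T \<Longrightarrow> worst T i j \<Longrightarrow> worst T i k \<Longrightarrow> j = k"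
  using pr_inj[of i j k] by (simp add: worst_def table_E le_antisym)

lemma best_subset: "best T i j \<Longrightarrow> T' \<subseteq> T \<Longrightarrow> (i, j) \<in> T' \<Longrightarrow> best T' i j"
  and worst_subset: "worst T i j \<Longrightarrow> T' \<subseteq> T \<Longrightarrow> (i, j) \<in> T' \<Longrightarrow> worst T' i j"
  by (auto simp: best_def worst_def)

lemma best_exists:
  assumes "(i, j) \<in> T" obtains k where "best T i k"
  using ex_has_least_nat[of "\<lambda>j. (i, j) \<in> T" j "pr i"] assms by (auto simp: best_def)

lemma worst_exists:
  assumes "table T" "(i, j) \<in> T" obtains k where "worst T i k"
proof -
  have "\<forall>k. (i, k) \<in> T \<longrightarrow> pr i k < Suc (Max (pr i ` V))"
    using assms E_sub finite_V by (auto simp: table_def intro!: le_imp_less_Suc Max_ge)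
  from ex_has_greatest_nat[OF assms(2) this] show ?thesis
    using that by (auto simp: worst_def)
qed

lemma best_strict: "table T \<Longrightarrow> best T i j \<Longrightarrow> (i, k) \<in> T \<Longrightarrow> k \<noteq> j \<Longrightarrow> pr i j < pr i k"
  using pr_inj[of i j k] by (auto simp: best_def table_E le_less)

lemma worst_strict: "table T \<Longrightarrow> worst T i j \<Longrightarrow> (i, k) \<in> T \<Longrightarrow> k \<noteq> j \<Longrightarrow> pr i k < pr i j"
  using pr_inj[of i k j] by (auto simp: worst_def table_E le_less)

section \<open>Invariants of a sequence of rejections\<close>

lemma rejection_table: "rejection T T' \<Longrightarrow> table T \<Longrightarrow> table T' \<and> T' \<subseteq> T"
  by (auto simp: rejection_def table_def cut_def)

lemma rejections_table: "rejection\<^sup>*\<^sup>* T T' \<Longrightarrow> table T \<Longrightarrow> table T' \<and> T' \<subseteq> T"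
  by (induction rule: rtranclp_induct) (use rejection_table in blast)+

text \<open>The recipient \<open>j\<close> can lose the proposal of \<open>i\<close> only by
  rejecting \<open>i\<close> itself, and it does so in favour of a proposer that it likes better and
  keeps.\<close>

lemma rejection_held:
  assumes "rejection T T'" "table T" "best T i j"
  shows "\<exists>i'. best T' i' j \<and> pr j i' \<le> pr j i"
proof -
  obtain i0 j0 k0 where s: "best T i0 j0" "worst T j0 k0" "k0 \<noteq> i0" "T' = cut j0 k0 T"
    using assms(1) by (auto simp: rejection_def)
  have "i0 \<noteq> j0" using s assms E_irrefl bestD table_E by metis
  then have p: "(i0, j0) \<in> T'" using s bestD(1)[OF s(1)] by (auto simp: cut_def)
  consider "(i, j) \<in> T'" | "i = j0" "j = k0" | "i = k0" "j = j0"
    using bestD(1)[OF assms(3)] s by (auto simp: cut_def)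
  then show ?thesis
  proof cases
    case 1
    then have "best T' i j" using best_subset[OF assms(3)] s(4) by (simp add: cut_def)
    then show ?thesis by blast
  next
    \<comment> \<open>Here \<open>i\<close> would reject its own first choice as the last entry of
      its list, but that list also contains \<open>i0\<close>.\<close>
    case 2
    have "(j0, i0) \<in> T" using s(1) assms(2) bestD tableD by metis
    then have "pr j0 k0 \<le> pr j0 i0" "pr j0 i0 < pr j0 k0"
      using 2 assms(3) bestD(2) worst_strict[OF assms(2) s(2)] s(3) by blast+
    then show ?thesis by simp
  next
    case 3
    have "best T' i0 j0" using best_subset[OF s(1) _ p] s(4) by (auto simp: cut_def)
    moreover have "pr j0 i0 \<le> pr j0 k0"
      using worstD(2)[OF s(2)] s(1) assms(2) bestD tableD by metis
    ultimately show ?thesis using 3 by blast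
  qed
qed

lemma rejections_held:
  assumes "rejection\<^sup>*\<^sup>* T T'" "table T" "best T i j"
  shows "\<exists>i'. best T' i' j \<and> pr j i' \<le> pr j i"
  using assms(1)
proof (induction rule: rtranclp_induct)
  case base
  then show ?case using assms by blast
next
  case (step T1 T2)
  then obtain i' where "best T1 i' j" "pr j i' \<le> pr j i" by blast
  then show ?case
    using rejection_held[OF step(2)] rejections_table[OF step(1) assms(2)] le_trans by blast
qed

lemma rejections_dominated:
  assumes "rejection\<^sup>*\<^sup>* T T'" "table T" "dominated T j k"
  shows "dominated T' j k"
proof -
  obtain i where "best T i j" "pr j i < pr j k" using assms(3) unfolding dominated_def by blast
  then show ?thesis
    using rejections_held[OF assms(1,2), of i j] le_less_trans unfolding dominated_def by blast
qed

text \<open>When \<open>j0\<close> rejects \<open>k0\<close>, it holds the preferred proposal of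
  \<open>i0\<close>, so the pair is dominated at that moment; \<open>rejections_dominated\<close>
  carries this to the final table.\<close>

lemma rejections_deleted:
  assumes "rejection\<^sup>*\<^sup>* T T'" "table T" "(j, k) \<in> T - T'"
  shows "dominated T' j k \<or> dominated T' k j"
  using assms(1,3)
proof (induction rule: rtranclp_induct)
  case base
  then show ?case by simp
next
  case (step T1 T2)
  have t: "table T1" using rejections_table step assms by blast
  have 1: "dominated T2 a b" if "dominated T1 a b" for a b
    using rejections_dominated[of T1 T2] step(2) t that by blast
  show ?case
  proof (cases "(j, k) \<in> T1")
    case False
    then show ?thesis using step 1 by blast
  next
    case True
    obtain i0 j0 k0 where s: "best T1 i0 j0" "worst T1 j0 k0" "k0 \<noteq> i0" "T2 = cut j0 k0 T1"
      using step(2) by (auto simp: rejection_def)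
    have "(j, k) = (j0, k0) \<or> (j, k) = (k0, j0)" using True step.prems s by (auto simp: cut_def)
    moreover have "pr j0 i0 < pr j0 k0"
      using worst_strict[OF t s(2)] s(1,3) t bestD tableD by metis
    then have "dominated T1 j0 k0" using s unfolding dominated_def by blast
    ultimately show ?thesis using 1 by blast
  qed
qed

subsection \<open>Balanced tables\<close>

definition active :: "('a \<times> 'a) set \<Rightarrow> 'a set" where
  "active T = {i. \<exists>j. (i, j) \<in> T}"

lemma activeI: "(i, j) \<in> T \<Longrightarrow> i \<in> active T"
  by (auto simp: active_def)

lemma finite_active: "table T \<Longrightarrow> finite (active T)"
  by (rule finite_subset[OF _ finite_V]) (use E_sub in \<open>auto simp: active_def table_def\<close>)

lemma active_mono: "T' \<subseteq> T \<Longrightarrow> active T' \<subseteq> active T"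
  by (auto simp: active_def)

text \<open>The favourite map of a balanced table is injective on the active agents, hence bijective.\<close>

lemma balanced_held:
  assumes "balanced T" "j \<in> active T"
  obtains i where "best T i j" "worst T j i"
proof -
  have t: "table T" using assms by (simp add: balanced_def)
  define F where "F i = (SOME j. best T i j)" for i
  have F: "best T i (F i)" if "i \<in> active T" for i
  proof -
    obtain j where "best T i j" using \<open>i \<in> active T\<close> best_exists unfolding active_def by blast
    then show ?thesis unfolding F_def by (rule someI)
  qed
  have "F ` active T \<subseteq> active T"
    using F bestD(1) tableD[OF t] activeI by blast
  moreover have "inj_on F (active T)"
  proof (rule inj_onI)
    fix i i' assume "i \<in> active T" "i' \<in> active T" "F i = F i'"
    then have "worst T (F i) i" "worst T (F i) i'"
      using F assms(1) unfolding balanced_def by metis+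
    then show "i = i'" by (rule worst_unique[OF t])
  qed
  ultimately have "F ` active T = active T"
    using finite_active[OF t] by (simp add: endo_inj_surj)
  then obtain i where i: "i \<in> active T" "F i = j" using assms(2) by (metis imageE)
  then have "best T i j" using F by blast
  then show ?thesis using that assms(1) unfolding balanced_def by simp
qed

text \<open>The converse of the definition of balance: by the counting in
  \<open>balanced_held\<close>, some agent proposes to \<open>j\<close> and is last there, and last
  entries are unique.\<close>

lemma balanced_worst:
  assumes "balanced T" "worst T j i" shows "best T i j"
proof -
  obtain i' where "best T i' j" "worst T j i'"
    using balanced_held[OF assms(1)] activeI[OF worstD(1)[OF assms(2)]] by blast
  then show ?thesis using assms worst_unique[of T j i i'] by (simp add: balanced_def)
qed

lemma balanced_iff: "balanced T \<Longrightarrow> best T i j \<longleftrightarrow> worst T j i"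
  using balanced_worst balanced_def by blast

definition single :: "('a \<times> 'a) set \<Rightarrow> 'a set" where
  "single T = {i. \<exists>j. (i, j) \<in> T \<and> (\<forall>k. (i, k) \<in> T \<longrightarrow> k = j)}"

lemma single_active: "single T \<subseteq> active T"
  by (auto simp: single_def active_def)

lemma best_worst_single: "table T \<Longrightarrow> best T i j \<Longrightarrow> worst T i j \<Longrightarrow> (i, k) \<in> T \<Longrightarrow> k = j"
  using best_strict[of T i j k] worst_strict[of T i j k] by fastforce

lemma single_iff:
  assumes "table T" shows "i \<in> single T \<longleftrightarrow> (\<exists>j. best T i j \<and> worst T i j)"
proof
  show "i \<in> single T \<Longrightarrow> \<exists>j. best T i j \<and> worst T i j"
    unfolding single_def best_def worst_def by blast
  show "\<exists>j. best T i j \<and> worst T i j \<Longrightarrow> i \<in> single T"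
    using best_worst_single[OF assms] bestD(1) unfolding single_def by blast
qed

text \<open>The only entry of \<open>i\<close> is both its first and its last, and balance exchanges
  these two roles on the side of \<open>j\<close>.\<close>

lemma balanced_single_partner:
  assumes "balanced T" "i \<in> single T" "(i, j) \<in> T" shows "j \<in> single T"
proof -
  have t: "table T" using assms by (simp add: balanced_def)
  obtain k where k: "best T i k" "worst T i k" using assms single_iff[OF t] by blast
  then have "k = j" using best_worst_single[OF t] assms(3) by blast
  then have "worst T j i" "best T j i" using k balanced_iff[OF assms(1)] by auto
  then show ?thesis using single_iff[OF t] by blast
qed

subsection \<open>Cutting off a first choice\<close>

text \<open>\<open>R\<close> collects the agents left out of odd cycles.\<close>

definition settled :: "('a \<times> 'a) set \<Rightarrow> 'a set \<Rightarrow> bool" where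
  "settled T R \<longleftrightarrow> balanced T \<and>
     (\<forall>i j. (i, j) \<in> E - T \<longrightarrow> i \<notin> R \<longrightarrow> j \<notin> R \<longrightarrow> dominated T i j \<or> dominated T j i)"

context
  fixes T T' x y
  assumes bal: "balanced T" and xy: "best T x y" and mult: "x \<notin> single T"
    and run: "rejection\<^sup>*\<^sup>* (cut x y T) T'" and bal': "balanced T'"
begin

lemma cut_table: "table T" "table T'" "table (cut x y T)"
  using bal bal' by (auto simp: balanced_def table_cut)

lemma cut_subset: "T' \<subseteq> T" "(x, y) \<notin> T'" "(y, x) \<notin> T'"
  using rejections_table[OF run cut_table(3)] by (auto simp: cut_def)

text \<open>The cut could also hurt \<open>y\<close> as a proposer, but \<open>x\<close> is not the
  favourite of \<open>y\<close>: balance would make \<open>y\<close> the last choice of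
  \<open>x\<close> as well, and \<open>x\<close> would be single.\<close>

lemma cut_best:
  assumes "best T i j" "j \<noteq> y" shows "best (cut x y T) i j"
proof -
  have "(i, j) \<noteq> (y, x)"
    using assms(1) mult xy cut_table balanced_iff[OF bal] single_iff by auto
  then show ?thesis
    using assms best_subset[OF assms(1), of "cut x y T"] bestD(1)[OF assms(1)]
    by (auto simp: cut_def)
qed

lemma cut_active: "active T - {y} \<subseteq> active T'"
proof
  fix j assume "j \<in> active T - {y}"
  then obtain i where "best T i j" "j \<noteq> y" using balanced_held[OF bal] by blast
  then have "\<exists>i'. best T' i' j"
    using cut_best rejections_held[OF run cut_table(3)] by blast
  then show "j \<in> active T'" using bestD(1) tableD[OF cut_table(2)] activeI by metis
qed

lemma cut_single_mono: "single T \<subseteq> single T'"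
proof
  fix i assume i: "i \<in> single T"
  have "y \<notin> single T"
    using mult balanced_single_partner[OF bal] xy bestD(1) tableD[OF cut_table(1)] by metis
  then have "i \<in> active T'" using i cut_active by (auto simp: single_def active_def)
  then show "i \<in> single T'" using i cut_subset(1) by (auto simp: single_def active_def)
qed

text \<open>Agents other than \<open>y\<close> still receive the proposals they held in
  \<open>T\<close>, so what they dominate stays dominated. If \<open>y\<close> keeps a list, it now
  holds a proposer strictly better than \<open>x\<close>, its last choice in \<open>T\<close>, and
  dominates at least as much as before. Otherwise it joins \<open>R\<close>, which exempts its
  pairs.\<close>

lemma cut_settled:
  assumes "settled T R" shows "settled T' (if y \<in> active T' then R else insert y R)"
proof -
  have y: "dominated T' y k" if y: "y \<in> active T'" and le: "pr y x \<le> pr y k" for k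
  proof -
    obtain i where i: "best T' i y" using balanced_held[OF bal' y] by blast
    then have "(y, i) \<in> T" "i \<noteq> x"
      using cut_subset bestD(1) tableD[OF cut_table(2)] by blast+
    moreover have "worst T y x" using xy balanced_iff[OF bal] by blast
    ultimately have "pr y i < pr y x" using worst_strict cut_table(1) by blast
    then show ?thesis using i le unfolding dominated_def by force
  qed
  have d: "dominated T' j k" if D: "dominated T j k" "j = y \<longrightarrow> y \<in> active T'" for j k
  proof (cases "j = y")
    case False
    then have "dominated (cut x y T) j k" using D(1) cut_best unfolding dominated_def by blast
    then show ?thesis using rejections_dominated[OF run cut_table(3)] by blast
  next
    case True
    then obtain i where "best T i y" "pr y i < pr y k" using D(1) unfolding dominated_def by blast
    moreover from this have "i = x"
      using xy balanced_iff[OF bal] worst_unique[OF cut_table(1)] by blast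
    ultimately show ?thesis using y D(2) True by auto
  qed
  show ?thesis
    unfolding settled_def
  proof (intro conjI allI impI)
    show "balanced T'" by (rule bal')
    fix i j
    assume ij: "(i, j) \<in> E - T'" "i \<notin> (if y \<in> active T' then R else insert y R)"
      "j \<notin> (if y \<in> active T' then R else insert y R)"
    then have R: "i \<notin> R" "j \<notin> R" "i = y \<longrightarrow> y \<in> active T'" "j = y \<longrightarrow> y \<in> active T'"
      by (auto split: if_splits)
    consider "(i, j) \<notin> T" | "(i, j) \<in> cut x y T - T'" | "(i, j) = (x, y)" | "(i, j) = (y, x)"
      using ij(1) by (auto simp: cut_def)
    then show "dominated T' i j \<or> dominated T' j i"
    proof cases
      case 1
      then have "dominated T i j \<or> dominated T j i" using assms ij(1) R unfolding settled_def by blast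
      then show ?thesis using d R by blast
    next
      case 2
      then show ?thesis using rejections_deleted[OF run cut_table(3)] by blast
    next
      case 3
      then show ?thesis using y R by auto
    next
      case 4
      then show ?thesis using y R by auto
    qed
  qed
qed

end

subsection \<open>Rotations\<close>

text \<open>\<open>g\<close> sends an agent to the agent that its second choice would reject in its favour. The
  rotation is eliminated on a set \<open>C\<close> permuted by \<open>g\<close>; \<open>no_odd\<close> excludes the odd cycles, on which
  elimination would empty a list.\<close>

lemma rotation_elimination:
  assumes bal: "balanced T"
    and F: "\<And>i. i \<in> active T \<Longrightarrow> best T i (F i)"
    and S: "\<And>i. i \<in> C \<Longrightarrow> (i, S i) \<in> T \<and> S i \<noteq> F i"
      "\<And>i k. i \<in> C \<Longrightarrow> (i, k) \<in> T \<Longrightarrow> k \<noteq> F i \<Longrightarrow> pr i (S i) \<le> pr i k"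
    and g: "\<And>i. i \<in> C \<Longrightarrow> worst T (S i) (g i)" "g ` C = C"
    and no_odd: "\<And>i. i \<in> C \<Longrightarrow> F i \<in> C \<Longrightarrow> S (F i) \<noteq> i"
  defines "D \<equiv> {(y, z). \<exists>x \<in> C. y = S x \<and> pr y x < pr y z}"
  defines "T' \<equiv> T - (D \<union> D\<inverse>)"
  shows "table T'" "T' \<subseteq> T" "active T \<subseteq> active T'" "balanced T'"
    "\<And>i j. (i, j) \<in> T - T' \<Longrightarrow> dominated T' i j \<or> dominated T' j i"
    "\<And>x. x \<in> C \<Longrightarrow> (x, F x) \<notin> T'"
proof -
  have t: "table T" using bal by (simp add: balanced_def)
  show t': "table T'" using t by (auto simp: table_def T'_def)
  show sub: "T' \<subseteq> T" by (auto simp: T'_def)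
  have CA: "i \<in> active T" if "i \<in> C" for i using S(1)[OF that] activeI by metis
  have finC: "finite C" using finite_subset[OF _ finite_active[OF t]] CA by blast
  have Fg: "F (g i) = S i" "best T (g i) (S i)" if "i \<in> C" for i
  proof -
    show 1: "best T (g i) (S i)" using balanced_worst[OF bal] g(1)[OF that] by blast
    have "g i \<in> C" using that g(2) by blast
    then show "F (g i) = S i" using F CA best_unique[OF t] 1 by blast
  qed
  have "inj_on g C" using finC g(2) by (simp add: eq_card_imp_inj_on)
  moreover have inj_F: "i = j" if "i \<in> active T" "j \<in> active T" "F i = F j" for i j
    using F[OF that(1)] F[OF that(2)] that(3) bal worst_unique[OF t] unfolding balanced_def by metis
  ultimately have inj_S: "i = j" if "i \<in> C" "j \<in> C" "S i = S j" for i j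
  proof -
    have "g i \<in> C" "g j \<in> C" using that g(2) by blast+
    then have "g i = g j" using Fg that inj_F[of "g i" "g j"] CA by metis
    then show ?thesis using \<open>inj_on g C\<close> that by (auto dest: inj_onD)
  qed
  have worse: "worst T (F i) i" if "i \<in> active T" for i
    using F that bal unfolding balanced_def by blast
  have pred: "\<exists>x \<in> C. g x = i \<and> S x = F i" if "i \<in> C" for i
  proof -
    have "i \<in> g ` C" using that g(2) by simp
    then obtain x where x: "x \<in> C" "g x = i" by blast
    then have "S x = F i" using Fg(1)[OF x(1)] by simp
    then show ?thesis using x by blast
  qed
  \<comment> \<open>The second choices on \<open>C\<close> become favourites, so elimination must
    spare them. From the side of \<open>S x\<close> a deletion is excluded by injectivity of
    \<open>S\<close>, from the side of \<open>x\<close> by \<open>no_odd\<close>.\<close>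
  have SD: "(x, S x) \<notin> D \<union> D\<inverse>" if x: "x \<in> C" for x
  proof
    assume "(x, S x) \<in> D \<union> D\<inverse>"
    then consider "(S x, x) \<in> D" | "(x, S x) \<in> D" by auto
    then show False
    proof cases
      case 1
      then show False using inj_S[OF x] unfolding D_def by force
    next
      case 2
      then obtain x2 where x2: "x2 \<in> C" "x = S x2" "pr x x2 < pr x (S x)" unfolding D_def by blast
      have "(x, x2) \<in> T" using S(1)[OF x2(1)] x2(2) tableD[OF t] by blast
      then have "x2 = F x" using S(2)[OF x] x2(3) by force
      then show False using no_odd[OF x] x2 by simp
    qed
  qed
  have ST: "(x, S x) \<in> T'" if "x \<in> C" for x
    using SD[OF that] S(1)[OF that] by (auto simp: T'_def)
  \<comment> \<open>As \<open>x = g x'\<close>, it is last on the list of its favourite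
    \<open>F x = S x'\<close>, which now keeps \<open>x'\<close> instead.\<close>
  show FT: "(x, F x) \<notin> T'" if x: "x \<in> C" for x
  proof -
    obtain x' where x': "x' \<in> C" "g x' = x" "S x' = F x" using pred[OF x] by blast
    have "x' \<noteq> x" using S(1)[OF x] x'(3) by auto
    moreover have "(F x, x') \<in> T" using S(1)[OF x'(1)] x'(3) tableD[OF t] by metis
    ultimately have "pr (F x) x' < pr (F x) x" using worst_strict[OF t] worse CA x by blast
    then have "(F x, x) \<in> D" using x' unfolding D_def by force
    then show ?thesis by (auto simp: T'_def)
  qed
  have bestC: "best T' x (S x)" if x: "x \<in> C" for x
    unfolding best_def using ST[OF x] FT[OF x] S(2)[OF x] sub by blast
  have worstC: "worst T' (S x) x" if x: "x \<in> C" for x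
    unfolding worst_def
  proof (intro conjI allI impI)
    show "(S x, x) \<in> T'" using ST[OF x] tableD[OF t'] by blast
    fix k assume "(S x, k) \<in> T'"
    then have "(S x, k) \<notin> D" by (auto simp: T'_def)
    then show "pr (S x) k \<le> pr (S x) x" using x unfolding D_def by force
  qed
  \<comment> \<open>Outside \<open>C\<close> favourites survive: \<open>F z\<close> rejects
    \<open>z\<close> only if \<open>F z = S x\<close> for some \<open>x\<close> in \<open>C\<close>,
    and then \<open>z = g x\<close> lies in \<open>C\<close>.\<close>
  have other: "(z, F z) \<in> T'" if z: "z \<in> active T" "z \<notin> C" for z
  proof -
    have "(z, F z) \<notin> D"
    proof
      assume "(z, F z) \<in> D"
      then obtain x where x: "x \<in> C" "z = S x" "pr z x < pr z (F z)" unfolding D_def by blast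
      then have "(z, x) \<in> T" using S(1) tableD[OF t] by blast
      then show False using bestD(2)[OF F[OF z(1)]] x(3) by force
    qed
    moreover have "(F z, z) \<notin> D"
    proof
      assume "(F z, z) \<in> D"
      then obtain x where "x \<in> C" "F z = S x" unfolding D_def by blast
      then have "g x \<in> C" "F (g x) = F z" using Fg(1) g(2) by auto
      moreover from this have "g x = z" using inj_F[OF CA z(1)] by blast
      ultimately show False using z(2) by simp
    qed
    moreover have "(z, F z) \<in> T" using F[OF z(1)] bestD(1) by blast
    ultimately show ?thesis by (auto simp: T'_def)
  qed
  show act: "active T \<subseteq> active T'" using ST other activeI by (metis subsetI)
  show "balanced T'"
    unfolding balanced_def
  proof (intro conjI allI impI t')
    fix i j assume ij: "best T' i j"
    have i: "i \<in> active T" using bestD(1)[OF ij] sub activeI by blast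
    show "worst T' j i"
    proof (cases "i \<in> C")
      case True
      then show ?thesis using bestC worstC best_unique[OF t' ij] by blast
    next
      case False
      have "best T' i (F i)" using best_subset[OF F[OF i] sub] other i False by blast
      then have "j = F i" using best_unique[OF t' ij] by blast
      then show ?thesis
        using worst_subset[OF worse[OF i] sub] other[OF i False] tableD[OF t'] by blast
    qed
  qed
  show "dominated T' i j \<or> dominated T' j i" if ij: "(i, j) \<in> T - T'" for i j
  proof -
    have "dominated T' y z" if "(y, z) \<in> D" for y z
      using that bestC unfolding D_def dominated_def by blast
    then show ?thesis using ij by (auto simp: T'_def)
  qed
qed

text \<open>The orbit of \<open>x0\<close> under \<open>g\<close> runs into a cycle
  \<open>C\<close>. Members of \<open>C\<close> that violate the condition for elimination have
  lists with only a first and a last entry, all inside the bad set, so this set cannot be entered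
  from outside. An orbit starting at \<open>x0\<close>, which has a third entry, therefore never
  meets it.\<close>

lemma rotation_exists:
  assumes bal: "balanced T" and x0: "(x0, k) \<in> T" "\<not> best T x0 k" "\<not> worst T x0 k"
  obtains x y T' where "best T x y" "x \<notin> single T" "balanced T'" "T' \<subseteq> cut x y T"
    "active T \<subseteq> active T'"
    "\<And>i j. (i, j) \<in> T - T' \<Longrightarrow> dominated T' i j \<or> dominated T' j i"
proof -
  have t: "table T" using bal by (simp add: balanced_def)
  define F where "F i = (SOME j. best T i j)" for i
  have F: "best T i (F i)" if "i \<in> active T" for i
  proof -
    obtain j where "best T i j" using \<open>i \<in> active T\<close> best_exists unfolding active_def by blast
    then show ?thesis unfolding F_def by (rule someI)
  qed
  have F_eq: "F i = j" if "best T i j" for i j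
    using best_unique[OF t _ that] F activeI[OF bestD(1)[OF that]] by blast
  define A where "A = active T - single T"
  define S where "S i = (SOME j. best (T - {(i, F i)}) i j)" for i
  have S: "(i, S i) \<in> T" "S i \<noteq> F i" "(i, j) \<in> T \<Longrightarrow> j \<noteq> F i \<Longrightarrow> pr i (S i) \<le> pr i j"
    if i: "i \<in> A" for i j
  proof -
    have "(i, F i) \<in> T" using F bestD(1) i unfolding A_def by blast
    then obtain j where "(i, j) \<in> T" "j \<noteq> F i" using i unfolding A_def single_def by blast
    then have "(i, j) \<in> T - {(i, F i)}" by blast
    then obtain j where "best (T - {(i, F i)}) i j" by (rule best_exists)
    then have "best (T - {(i, F i)}) i (S i)" unfolding S_def by (rule someI)
    then show "(i, S i) \<in> T" "S i \<noteq> F i" "(i, j) \<in> T \<Longrightarrow> j \<noteq> F i \<Longrightarrow> pr i (S i) \<le> pr i j" for j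
      unfolding best_def by auto
  qed
  define g where "g i = (SOME j. worst T (S i) j)" for i
  have g: "worst T (S i) (g i)" if i: "i \<in> A" for i
  proof -
    obtain j where "worst T (S i) j" using worst_exists[OF t] tableD[OF t S(1)[OF i]] by blast
    then show ?thesis unfolding g_def by (rule someI)
  qed
  have gA: "g i \<in> A" and Fg: "F (g i) = S i" if i: "i \<in> A" for i
  proof -
    have b: "best T (g i) (S i)" using g[OF i] balanced_worst[OF bal] by blast
    then show 1: "F (g i) = S i" by (rule F_eq)
    then have 2: "g i \<noteq> i" using S(2)[OF i] by auto
    have "g i \<notin> single T"
    proof
      assume "g i \<in> single T"
      then have "S i \<in> single T" using balanced_single_partner[OF bal] bestD(1)[OF b] by blast
      moreover have "(S i, i) \<in> T" "(S i, g i) \<in> T"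
        using S(1)[OF i] tableD[OF t] bestD(1)[OF b] by blast+
      ultimately show False using 2 unfolding single_def by blast
    qed
    then show "g i \<in> A" using activeI[OF bestD(1)[OF b]] by (simp add: A_def)
  qed
  have x0A: "x0 \<in> A"
    using x0 best_worst_single[OF t, of x0] single_iff[OF t] activeI unfolding A_def by blast
  define Orb where "Orb = {(g ^^ n) x0 | n. True}"
  have "(g ^^ n) x0 \<in> A" for n by (induction n) (use x0A gA in auto)
  then have OA: "Orb \<subseteq> A" unfolding Orb_def by blast
  have gO: "g i \<in> Orb" if "i \<in> Orb" for i
  proof -
    obtain n where "i = (g ^^ n) x0" using \<open>i \<in> Orb\<close> unfolding Orb_def by blast
    then have "g i = (g ^^ Suc n) x0" by simp
    then show ?thesis unfolding Orb_def by blast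
  qed
  have finO: "finite Orb" using OA finite_active[OF t] unfolding A_def by (meson finite_Diff finite_subset)
  \<comment> \<open>A nonempty \<open>g\<close>-closed set of least cardinality is permuted by
    \<open>g\<close>, because its image is again \<open>g\<close>-closed; this isolates the cycle
    without computing a period.\<close>
  have "Orb \<subseteq> Orb \<and> Orb \<noteq> {} \<and> g ` Orb \<subseteq> Orb" using gO unfolding Orb_def by blast
  from ex_has_least_nat[of "\<lambda>C. C \<subseteq> Orb \<and> C \<noteq> {} \<and> g ` C \<subseteq> C", OF this, of card]
  obtain C where C0: "(C \<subseteq> Orb \<and> C \<noteq> {} \<and> g ` C \<subseteq> C) \<and>
      (\<forall>C'. C' \<subseteq> Orb \<and> C' \<noteq> {} \<and> g ` C' \<subseteq> C' \<longrightarrow> card C \<le> card C')"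
    by (rule exE)
  then have C: "C \<subseteq> Orb" "C \<noteq> {}" "g ` C \<subseteq> C" by simp_all
  have least: "card C \<le> card C'" if "C' \<subseteq> Orb" "C' \<noteq> {}" "g ` C' \<subseteq> C'" for C'
    using C0 that by simp
  have finC: "finite C" using C(1) finO finite_subset by blast
  have "card C \<le> card (g ` C)"
    by (rule least) (use C(1,3) in blast, use C(2) in simp, use C(3) in \<open>rule image_mono\<close>)
  then have gC: "g ` C = C" by (intro card_seteq[OF finC C(3)])
  have CA: "i \<in> A" if "i \<in> C" for i using that C OA by blast
  have inj_F: "i = j" if "i \<in> active T" "j \<in> active T" "F i = F j" for i j
    using F[OF that(1)] F[OF that(2)] that(3) bal worst_unique[OF t] unfolding balanced_def by metis
  \<comment> \<open>The obstructions to \<open>no_odd\<close>. For \<open>i\<close> in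
    \<open>B\<close>, the agent \<open>F i\<close> has \<open>i\<close> as second choice and, by
    balance, as last choice, so nothing lies between its first and last entries.\<close>
  define B where "B = {i \<in> C. F i \<in> C \<and> S (F i) = i}"
  have BF: "F i \<in> B" "\<And>k. (F i, k) \<in> T \<Longrightarrow> k = i \<or> k = F (F i)" if i: "i \<in> B" for i
  proof -
    let ?y = "F i"
    have y: "i \<in> C" "?y \<in> C" "S ?y = i" using i unfolding B_def by auto
    have "best T i ?y" using F CA[OF y(1)] unfolding A_def by blast
    then have wy: "worst T ?y i" using balanced_iff[OF bal] by blast
    show row: "k = i \<or> k = F ?y" if "(?y, k) \<in> T" for k
    proof (rule ccontr)
      assume k: "\<not> (k = i \<or> k = F ?y)"
      then have "pr ?y i \<le> pr ?y k" using S(3)[OF CA[OF y(2)] that] y(3) by simp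
      then show False using worst_strict[OF t wy that] k by force
    qed
    have "i \<in> g ` C" using y(1) gC by simp
    then obtain x where x: "x \<in> C" "g x = i" by blast
    then have Sx: "S x = ?y" using Fg[OF CA[OF x(1)]] by simp
    then have "(?y, x) \<in> T" using S(1)[OF CA[OF x(1)]] tableD[OF t] by metis
    moreover have "x \<noteq> i" using S(2)[OF CA[OF y(1)]] Sx by blast
    ultimately have "x = F ?y" using row by blast
    then show "?y \<in> B" using x Sx y unfolding B_def by simp
  qed
  have BC: "B \<subseteq> C" unfolding B_def by blast
  then have BA: "i \<in> active T" if "i \<in> B" for i using that CA unfolding A_def by blast
  have "F ` B \<subseteq> B" using BF(1) by (rule image_subsetI)
  moreover have "inj_on F B" by (rule inj_onI) (rule inj_F[OF BA BA])
  moreover have "finite B" using BC finC finite_subset by blast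
  ultimately have FB: "F ` B = B" by (simp add: endo_inj_surj)
  have rowB: "k \<in> B \<and> (best T i k \<or> worst T i k)" if "i \<in> B" "(i, k) \<in> T" for i k
  proof -
    have "i \<in> F ` B" using that(1) FB by simp
    then obtain j where j: "j \<in> B" "i = F j" by blast
    have a: "i \<in> active T" "j \<in> active T" using that(1) j(1) BA by blast+
    have "k = j \<or> k = F i" using BF(2)[OF j(1)] that(2) j(2) by blast
    moreover have "worst T i j" using F[OF a(2)] j(2) balanced_iff[OF bal] by blast
    moreover have "best T i (F i)" using F[OF a(1)] .
    moreover have "F i \<in> B" using BF(1)[OF that(1)] .
    ultimately show ?thesis using j(1) by blast
  qed
  \<comment> \<open>\<open>S i = F (g i)\<close> is in \<open>B\<close> and has \<open>i\<close> on
    its list, and the lists of members of \<open>B\<close> stay within \<open>B\<close>.\<close>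
  have Bback: "i \<in> B" if "i \<in> A" "g i \<in> B" for i
  proof -
    have "S i \<in> B" using BF(1)[OF that(2)] Fg[OF that(1)] by simp
    then show ?thesis using rowB tableD[OF t S(1)[OF that(1)]] by blast
  qed
  have "B = {}"
  proof (rule ccontr)
    assume "B \<noteq> {}"
    then obtain n where "(g ^^ n) x0 \<in> B" using C(1) BC unfolding Orb_def by blast
    then have "x0 \<in> B"
    proof (induction n)
      case (Suc n)
      have "(g ^^ n) x0 \<in> A" using OA unfolding Orb_def by blast
      then show ?case using Suc Bback by simp
    qed simp
    then show False using rowB[OF _ x0(1)] x0 by blast
  qed
  then have no_odd: "S (F i) \<noteq> i" if "i \<in> C" "F i \<in> C" for i using that unfolding B_def by blast
  define T' where "T' = T - ({(y, z). \<exists>x \<in> C. y = S x \<and> pr y x < pr y z} \<union>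
    {(y, z). \<exists>x \<in> C. y = S x \<and> pr y x < pr y z}\<inverse>)"
  have S': "\<And>i. i \<in> C \<Longrightarrow> (i, S i) \<in> T \<and> S i \<noteq> F i"
      "\<And>i k. i \<in> C \<Longrightarrow> (i, k) \<in> T \<Longrightarrow> k \<noteq> F i \<Longrightarrow> pr i (S i) \<le> pr i k"
      "\<And>i. i \<in> C \<Longrightarrow> worst T (S i) (g i)"
    using S CA g by blast+
  note rot = rotation_elimination[OF bal F S' gC no_odd, folded T'_def]
  obtain x where x: "x \<in> C" using C(2) by blast
  have sub: "T' \<subseteq> T" by (rule rot(2); assumption)
  have bal': "balanced T'" by (rule rot(4); assumption)
  have "(x, F x) \<notin> T'" by (rule rot(6)) (assumption | rule x)+
  moreover from this have "(F x, x) \<notin> T'" using tableD bal' unfolding balanced_def by blast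
  ultimately have cut: "T' \<subseteq> cut x (F x) T" using sub unfolding cut_def by blast
  show ?thesis
  proof (rule that[OF _ _ bal' cut])
    show "best T x (F x)" "x \<notin> single T" using CA[OF x] F unfolding A_def by auto
    show "active T \<subseteq> active T'" by (rule rot(3); assumption)
    show "dominated T' i j \<or> dominated T' j i" if "(i, j) \<in> T - T'" for i j
      by (rule rot(5)) (assumption | rule that)+
  qed
qed

text \<open>Suppose \<open>i\<close> makes \<open>j\<close> reject \<open>k\<close>. If
  \<open>i\<close> is on the list of \<open>j\<close> in \<open>T'\<close>, balance puts it last
  there. Otherwise the pair of \<open>i\<close> and \<open>j\<close> is dominated in
  \<open>T'\<close>: not at \<open>i\<close>, whose favourite in the larger table \<open>T1\<close>
  is \<open>j\<close>, hence at \<open>j\<close>, whose last entry in \<open>T'\<close> is then even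
  better than \<open>i\<close>. Either way \<open>k\<close> lies beyond the end of the list of
  \<open>j\<close> in \<open>T'\<close>.\<close>

lemma rejection_above:
  assumes "rejection T1 T2" "T' \<subseteq> T1" "T1 \<subseteq> T" "table T1" "balanced T'"
    and dom: "\<And>i j. (i, j) \<in> T - T' \<Longrightarrow> dominated T' i j \<or> dominated T' j i"
  shows "T' \<subseteq> T2"
proof -
  obtain i j k where s: "best T1 i j" "worst T1 j k" "k \<noteq> i" "T2 = cut j k T1"
    using assms(1) by (auto simp: rejection_def)
  have t': "table T'" using assms by (simp add: balanced_def)
  have ji: "(j, i) \<in> T1" using bestD(1)[OF s(1)] tableD[OF assms(4)] by blast
  then have less: "pr j i < pr j k" using worst_strict[OF assms(4) s(2)] s(3) by blast
  have "(j, k) \<notin> T'"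
  proof
    assume jk: "(j, k) \<in> T'"
    show False
    proof (cases "(i, j) \<in> T'")
      case True
      then have "best T' i j" using best_subset[OF s(1) assms(2)] by blast
      then have "worst T' j i" using assms(5) by (simp add: balanced_def)
      then show False using worstD(2)[OF _ jk] less by force
    next
      case False
      then have "dominated T' i j \<or> dominated T' j i"
        using dom bestD(1)[OF s(1)] assms(3) by blast
      then show False
      proof
        assume "dominated T' i j"
        then obtain z where z: "best T' z i" "pr i z < pr i j" by (auto simp: dominated_def)
        then have "(i, z) \<in> T1" using bestD(1) tableD[OF t'] assms(2) by blast
        then show False using bestD(2)[OF s(1)] z(2) by force
      next
        assume "dominated T' j i"
        then obtain z where z: "best T' z j" "pr j z < pr j i" by (auto simp: dominated_def)
        then have "worst T' j z" using assms(5) by (simp add: balanced_def)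
        then show False using worstD(2)[OF _ jk] less z(2) by force
      qed
    qed
  qed
  then show ?thesis using s(4) assms(2) tableD[OF t'] unfolding cut_def by blast
qed

lemma rejections_above:
  assumes "rejection\<^sup>*\<^sup>* T1 T2" "T' \<subseteq> T1" "T1 \<subseteq> T" "table T1" "balanced T'"
    and "\<And>i j. (i, j) \<in> T - T' \<Longrightarrow> dominated T' i j \<or> dominated T' j i"
  shows "T' \<subseteq> T2"
  using assms(1)
proof (induction rule: rtranclp_induct)
  case (step T2 T3)
  have "table T2" "T2 \<subseteq> T" using rejections_table[OF step(1) assms(4)] assms(3) by auto
  then show ?case using rejection_above[OF step(2,3)] assms(5,6) by blast
qed (use assms in simp)

text \<open>The assumptions say that the list of \<open>x0\<close> has at least three entries.\<close>

lemma safe_cut_exists: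
  assumes "balanced T" "(x0, k) \<in> T" "\<not> best T x0 k" "\<not> worst T x0 k"
  obtains x y where "best T x y" "x \<notin> single T"
    "\<And>T'. rejection\<^sup>*\<^sup>* (cut x y T) T' \<Longrightarrow> y \<in> active T'"
proof -
  obtain x y T0 where r: "best T x y" "x \<notin> single T" "balanced T0" "T0 \<subseteq> cut x y T"
    "active T \<subseteq> active T0" "\<And>i j. (i, j) \<in> T - T0 \<Longrightarrow> dominated T0 i j \<or> dominated T0 j i"
    using rotation_exists[OF assms] by blast
  have t: "table T" using assms by (simp add: balanced_def)
  have "y \<in> active T0" using r(1,5) bestD(1) tableD[OF t] activeI by blast
  moreover have "T0 \<subseteq> T'" if "rejection\<^sup>*\<^sup>* (cut x y T) T'" for T'
    by (rule rejections_above[OF that r(4) _ table_cut[OF t] r(3,6)]) (auto simp: cut_def)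
  ultimately show ?thesis using that[OF r(1,2)] active_mono by blast
qed

subsection \<open>Breaking odd cycles\<close>

text \<open>The favourite \<open>x2\<close> of \<open>y\<close> has only \<open>y\<close> and its
  own favourite \<open>x3\<close> on its list. When \<open>y\<close> vanishes, \<open>x2\<close>
  stays active, so \<open>x2\<close> and \<open>x3\<close> are left with each other. Neither was
  single before, since singleness passes along entries and \<open>y\<close> was not single.\<close>

lemma cut_single_gain:
  assumes bal: "balanced T" and xy: "best T x y" and mult: "x \<notin> single T"
    and run: "rejection\<^sup>*\<^sup>* (cut x y T) T'" and bal': "balanced T'"
    and two: "\<And>i j. (i, j) \<in> T \<Longrightarrow> best T i j \<or> worst T i j"
    and gone: "y \<notin> active T'"
  shows "card (single T) + 2 \<le> card (single T')"
proof -
  note t = cut_table[OF bal xy mult run bal']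
  note sub = cut_subset[OF bal xy mult run bal']
  note act = cut_active[OF bal xy mult run bal']
  have yx: "worst T y x" using xy balanced_iff[OF bal] by blast
  have y: "y \<notin> single T" using mult balanced_single_partner[OF bal] bestD(1)[OF xy] tableD[OF t(1)] by metis
  obtain x2 where x2: "best T y x2" using best_exists worstD(1)[OF yx] by blast
  then have "x2 \<noteq> x" using y yx single_iff[OF t(1)] by blast
  have wx2: "worst T x2 y" using x2 balanced_iff[OF bal] by blast
  have x2s: "x2 \<notin> single T" using y balanced_single_partner[OF bal] worstD(1)[OF wx2] by blast
  obtain x3 where x3: "best T x2 x3" using best_exists worstD(1)[OF wx2] by blast
  have x3s: "x3 \<notin> single T"
    using x2s balanced_single_partner[OF bal] bestD(1)[OF x3] tableD[OF t(1)] by blast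
  have ne: "x2 \<noteq> y" "x3 \<noteq> x2"
    using E_irrefl table_E[OF t(1)] bestD(1)[OF x2] bestD(1)[OF x3] by blast+
  have row: "k = x3" if "(x2, k) \<in> T'" for k
  proof -
    have "(x2, k) \<in> T" using that sub by blast
    then have "k = x3 \<or> k = y"
      using two best_unique[OF t(1) x3] worst_unique[OF t(1) wx2] by blast
    moreover have "k \<noteq> y" using that gone tableD[OF t(2)] activeI by blast
    ultimately show ?thesis by blast
  qed
  have "x2 \<in> active T'" using act activeI[OF worstD(1)[OF wx2]] ne(1) by blast
  then have "x2 \<in> single T'" using row unfolding single_def active_def by blast
  moreover have "(x2, x3) \<in> T'" using \<open>x2 \<in> active T'\<close> row unfolding active_def by blast
  ultimately have "x3 \<in> single T'" "x2 \<in> single T'" using balanced_single_partner[OF bal'] by blast+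
  then have "single T \<union> {x2, x3} \<subseteq> single T'"
    using cut_single_mono[OF bal xy mult run bal'] by blast
  moreover have "finite (single T')"
    using finite_subset[OF single_active finite_active[OF t(2)]] .
  ultimately have "card (single T \<union> {x2, x3}) \<le> card (single T')" by (simp add: card_mono)
  moreover have "finite (single T)"
    using finite_subset[OF single_active finite_active[OF t(1)]] .
  then have "card (single T \<union> {x2, x3}) = card (single T) + 2"
    using x2s x3s ne(2) by (simp add: card_Un_disjoint)
  ultimately show ?thesis by simp
qed

end

section \<open>Polynomial-time functions\<close>

definition reach :: "prog \<Rightarrow> store \<Rightarrow> nat \<Rightarrow> (store \<Rightarrow> bool) \<Rightarrow> bool" where
  "reach p s T Q \<longleftrightarrow> (\<exists>t s'. run p s t s' \<and> t \<le> T \<and> Q s')"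

lemma reach_mono: "reach p s T Q \<Longrightarrow> T \<le> T' \<Longrightarrow> (\<And>s'. Q s' \<Longrightarrow> Q' s') \<Longrightarrow> reach p s T' Q'"
  unfolding reach_def by (meson le_trans)

lemma reach_Assign: "Q (s(x := expr_val e s)) \<Longrightarrow> reach (Assign x e) s (expr_cost e + 1) Q"
  unfolding reach_def using run_Assign by blast

lemma reach_Seq:
  assumes "reach p s T (\<lambda>s'. reach q s' U Q)" shows "reach (Seq p q) s (T + U) Q"
proof -
  obtain t s' u s'' where "run p s t s'" "t \<le> T" "run q s' u s''" "u \<le> U" "Q s''"
    using assms unfolding reach_def by blast
  then show ?thesis unfolding reach_def using run_Seq add_mono by blast
qed

lemma reach_Assign_Seq:
  "reach q (s(x := expr_val e s)) U Q \<Longrightarrow> reach (Seq (Assign x e) q) s (expr_cost e + 1 + U) Q"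
  by (rule reach_Seq[OF reach_Assign])

lemma reach_If:
  assumes "expr_val e s \<noteq> Leaf \<Longrightarrow> reach p s T Q" "expr_val e s = Leaf \<Longrightarrow> reach q s T Q"
  shows "reach (If e p q) s (expr_cost e + 1 + T) Q"
proof (cases "expr_val e s = Leaf")
  case True
  then obtain t s' where "run q s t s'" "t \<le> T" "Q s'"
    using assms(2) unfolding reach_def by blast
  then show ?thesis unfolding reach_def using run_IfFalse[OF True] by (meson add_left_mono)
next
  case False
  then obtain t s' where "run p s t s'" "t \<le> T" "Q s'"
    using assms(1) unfolding reach_def by blast
  then show ?thesis unfolding reach_def using run_IfTrue[OF False] by (meson add_left_mono)
qed

lemma reach_WhileFalse: "expr_val e s = Leaf \<Longrightarrow> Q s \<Longrightarrow> reach (While e p) s (expr_cost e + 1) Q"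
  unfolding reach_def using run_WhileFalse by blast

lemma reach_WhileTrue:
  assumes "expr_val e s \<noteq> Leaf" "reach p s T (\<lambda>s'. reach (While e p) s' U Q)"
  shows "reach (While e p) s (expr_cost e + 1 + T + U) Q"
proof -
  obtain t s' u s'' where "run p s t s'" "t \<le> T" "run (While e p) s' u s''" "u \<le> U" "Q s''"
    using assms(2) unfolding reach_def by blast
  then show ?thesis unfolding reach_def using run_WhileTrue[OF assms(1)]
    by (meson add_left_mono add_mono)
qed

lemma poly_mono_nat: "m \<le> n \<Longrightarrow> poly (q :: nat poly) m \<le> poly q n"
  by (induction q) (simp_all add: mult_mono)

text \<open>A program may use the variables below \<open>m\<close> and must leave all others alone, whatever they
  contain; the bound on the size of the output is needed because \<open>Node (Var x) (Var x)\<close> doubles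
  the size of a tree in constant time.\<close>

definition implements ::
  "prog \<Rightarrow> nat \<Rightarrow> nat poly \<Rightarrow> ('a \<Rightarrow> tree) \<Rightarrow> ('b \<Rightarrow> tree) \<Rightarrow> ('a \<Rightarrow> 'b) \<Rightarrow> bool" where
  "implements p m q ea eb f \<longleftrightarrow> (\<forall>x. size (eb (f x)) \<le> poly q (size (ea x)) \<and>
     (\<forall>s. s 0 = ea x \<longrightarrow>
       reach p s (poly q (size (ea x))) (\<lambda>s'. s' 0 = eb (f x) \<and> (\<forall>v\<ge>m. s' v = s v))))"

definition poly_time :: "('a \<Rightarrow> tree) \<Rightarrow> ('b \<Rightarrow> tree) \<Rightarrow> ('a \<Rightarrow> 'b) \<Rightarrow> bool" where
  "poly_time ea eb f \<longleftrightarrow> (\<exists>p m q. implements p m q ea eb f)"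

lemma implements_size: "implements p m q ea eb f \<Longrightarrow> size (eb (f x)) \<le> poly q (size (ea x))"
  by (simp add: implements_def)

lemma implements_run:
  assumes "implements p m q ea eb f" "s 0 = ea x" "poly q (size (ea x)) \<le> T"
    "\<And>s'. s' 0 = eb (f x) \<Longrightarrow> (\<And>v. v \<ge> m \<Longrightarrow> s' v = s v) \<Longrightarrow> Q s'"
  shows "reach p s T Q"
proof -
  have "reach p s (poly q (size (ea x))) (\<lambda>s'. s' 0 = eb (f x) \<and> (\<forall>v\<ge>m. s' v = s v))"
    using assms(1,2) by (simp add: implements_def)
  then show ?thesis by (rule reach_mono) (use assms(3,4) in auto)
qed

definition enc_pair :: "('a \<Rightarrow> tree) \<Rightarrow> ('b \<Rightarrow> tree) \<Rightarrow> 'a \<times> 'b \<Rightarrow> tree" where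
  "enc_pair ea eb z = Fork (ea (fst z)) (eb (snd z))"

definition enc_bool :: "bool \<Rightarrow> tree" where
  "enc_bool b = (if b then Fork Leaf Leaf else Leaf)"

text \<open>The same program serves, since only the output tree counts. This gives for free every
  function that merely reinterprets a tree.\<close>

lemma poly_time_recode:
  assumes "poly_time ea eb f" "\<And>x. ec (g x) = eb (f x)" shows "poly_time ea ec g"
  using assms by (simp add: poly_time_def implements_def)

lemma poly_time_expr:
  assumes "\<And>x s. s 0 = ea x \<Longrightarrow> expr_val e s = eb (f x)"
    and "\<And>x. size (eb (f x)) \<le> size (ea x) + k"
  shows "poly_time ea eb f"
proof -
  have "implements (Assign 0 e) 1 [:k + expr_cost e + 1, 1:] ea eb f"
    unfolding implements_def
  proof (intro allI conjI impI)
    fix x show "size (eb (f x)) \<le> poly [:k + expr_cost e + 1, 1:] (size (ea x))"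
      using assms(2)[of x] by simp
    fix s :: store assume "s 0 = ea x"
    then have "reach (Assign 0 e) s (expr_cost e + 1) (\<lambda>s'. s' 0 = eb (f x) \<and> (\<forall>v\<ge>1. s' v = s v))"
      by (intro reach_Assign) (simp add: assms(1))
    then show "reach (Assign 0 e) s (poly [:k + expr_cost e + 1, 1:] (size (ea x)))
        (\<lambda>s'. s' 0 = eb (f x) \<and> (\<forall>v\<ge>1. s' v = s v))"
      by (rule reach_mono) auto
  qed
  then show ?thesis by (auto simp: poly_time_def)
qed

lemma poly_time_id: "poly_time ea ea (\<lambda>x. x)"
  by (rule poly_time_expr[of _ "Var 0" _ _ 0]) auto

fun quote :: "tree \<Rightarrow> expr" where
  "quote Leaf = Empty"
| "quote (Fork l r) = Node (quote l) (quote r)"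

lemma expr_val_quote: "expr_val (quote x) s = x"
  by (induction x) auto

lemma poly_time_const: "poly_time ea eb (\<lambda>_. y)"
  by (rule poly_time_expr[of _ "quote (eb y)" _ _ "size (eb y)"]) (auto simp: expr_val_quote)

lemma poly_time_comp:
  assumes "poly_time ea eb f" "poly_time eb ec g" shows "poly_time ea ec (\<lambda>x. g (f x))"
proof -
  obtain p m q p' m' q' where i: "implements p m q ea eb f" "implements p' m' q' eb ec g"
    using assms unfolding poly_time_def by blast
  have b: "poly q' (size (eb (f x))) \<le> poly (pcompose q' q) (size (ea x))" for x
    using poly_mono_nat[OF implements_size[OF i(1)]] by (simp add: poly_pcompose)
  have "implements (Seq p p') (max m m') (q + pcompose q' q) ea ec (\<lambda>x. g (f x))"
    unfolding implements_def poly_add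
  proof (intro allI conjI impI)
    fix x show "size (ec (g (f x))) \<le> poly q (size (ea x)) + poly (pcompose q' q) (size (ea x))"
      using implements_size[OF i(2), of "f x"] b[of x] by simp
    fix s :: store assume s: "s 0 = ea x"
    show "reach (Seq p p') s (poly q (size (ea x)) + poly (pcompose q' q) (size (ea x)))
        (\<lambda>s'. s' 0 = ec (g (f x)) \<and> (\<forall>v\<ge>max m m'. s' v = s v))"
      by (rule reach_Seq, rule implements_run[where s = s, OF i(1) s order_refl],
          rule implements_run[OF i(2) _ b]) auto
  qed
  then show ?thesis by (auto simp: poly_time_def)
qed

lemma poly_time_pair:
  assumes "poly_time ea eb f" "poly_time ea ec g"
  shows "poly_time ea (enc_pair eb ec) (\<lambda>x. (f x, g x))"
proof -
  obtain p m q p' m' q' where i: "implements p m q ea eb f" "implements p' m' q' ea ec g"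
    using assms unfolding poly_time_def by blast
  \<comment> \<open>A positive index beyond the variables of both programs, so both preserve it:
    \<open>v\<close> saves the input and \<open>Suc v\<close> the first result.\<close>
  define v where "v = Suc (max m m')"
  have v: "v \<noteq> 0" "m \<le> v" "m' \<le> v" by (auto simp: v_def)
  let ?p = "Seq (Assign v (Var 0)) (Seq p (Seq (Assign (Suc v) (Var 0)) (Seq (Assign 0 (Var v))
      (Seq p' (Assign 0 (Node (Var (Suc v)) (Var 0)))))))"
  let ?T = "\<lambda>x. (1 + 1) + (poly q (size (ea x)) + ((1 + 1) + ((1 + 1) + (poly q' (size (ea x)) + (3 + 1)))))"
  have *: "reach ?p s (?T x) (\<lambda>s'. s' 0 = enc_pair eb ec (f x, g x) \<and> (\<forall>w\<ge>v + 2. s' w = s w))"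
    if s: "s 0 = ea x" for s x
  proof -
    have 1: "reach (Seq p' (Assign 0 (Node (Var (Suc v)) (Var 0)))) s2 (poly q' (size (ea x)) + (3 + 1))
        (\<lambda>s'. s' 0 = enc_pair eb ec (f x, g x) \<and> (\<forall>w\<ge>v + 2. s' w = s2 w))"
      if "s2 0 = ea x" "s2 (Suc v) = eb (f x)" for s2
      by (rule reach_Seq, rule implements_run[where s = s2, OF i(2) that(1) order_refl],
          rule reach_mono[OF reach_Assign]) (use that v in \<open>auto simp: enc_pair_def\<close>)
    show ?thesis
    proof (rule reach_mono, rule reach_Assign_Seq, rule reach_Seq,
        rule implements_run[OF i(1) _ order_refl])
      let ?s = "s(v := expr_val (Var 0) s)"
      show "?s 0 = ea x" using s v by simp
      fix s1 assume "s1 0 = eb (f x)" "\<And>w. w \<ge> m \<Longrightarrow> s1 w = ?s w"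
      then show "reach (Seq (Assign (Suc v) (Var 0)) (Seq (Assign 0 (Var v))
          (Seq p' (Assign 0 (Node (Var (Suc v)) (Var 0)))))) s1
          (expr_cost (Var 0) + 1 + (expr_cost (Var v) + 1 + (poly q' (size (ea x)) + (3 + 1))))
          (\<lambda>s'. s' 0 = enc_pair eb ec (f x, g x) \<and> (\<forall>w\<ge>v + 2. s' w = s w))"
        by (intro reach_Assign_Seq reach_mono[OF 1]) (use s v in auto)
    qed auto
  qed
  have "implements ?p (v + 2) ([:11:] + q + q') ea (enc_pair eb ec) (\<lambda>x. (f x, g x))"
    unfolding implements_def poly_add
  proof (intro allI conjI impI)
    fix x
    show "size (enc_pair eb ec (f x, g x)) \<le>
        poly [:11:] (size (ea x)) + poly q (size (ea x)) + poly q' (size (ea x))"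
      using implements_size[OF i(1), of x] implements_size[OF i(2), of x] by (simp add: enc_pair_def)
    fix s :: store assume "s 0 = ea x"
    from *[where s = s and x = x, OF this] show "reach ?p s (poly [:11:] (size (ea x)) + poly q (size (ea x)) + poly q' (size (ea x)))
        (\<lambda>s'. s' 0 = enc_pair eb ec (f x, g x) \<and> (\<forall>w\<ge>v + 2. s' w = s w))"
      by (rule reach_mono) auto
  qed
  then show ?thesis by (auto simp: poly_time_def)
qed

text \<open>\<open>None\<close> is coded as \<open>Leaf\<close>, so the test of \<open>If\<close> is
  the case distinction and \<open>Tl\<close> strips the constructor. The time bound adds up both
  branches in order to cover either.\<close>

lemma poly_time_case:
  assumes "poly_time ea (enc_option eb) o'" "poly_time ea ec n"
    "poly_time (enc_pair ea eb) ec (\<lambda>z. h (fst z) (snd z))"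
  shows "poly_time ea ec (\<lambda>x. case o' x of None \<Rightarrow> n x | Some y \<Rightarrow> h x y)"
proof -
  obtain p1 m1 q1 p2 m2 q2 p3 m3 q3 where i: "implements p1 m1 q1 ea (enc_option eb) o'"
    "implements p2 m2 q2 ea ec n" "implements p3 m3 q3 (enc_pair ea eb) ec (\<lambda>z. h (fst z) (snd z))"
    using assms unfolding poly_time_def by blast
  define v where "v = Suc (max m1 (max m2 m3))"
  have v: "v \<noteq> 0" "m1 \<le> v" "m2 \<le> v" "m3 \<le> v" by (auto simp: v_def)
  let ?r = "\<lambda>x. case o' x of None \<Rightarrow> n x | Some y \<Rightarrow> h x y"
  let ?q3 = "pcompose q3 ([:1, 1:] + q1)"
  let ?p = "Seq (Assign v (Var 0)) (Seq p1
      (If (Var 0) (Seq (Assign 0 (Node (Var v) (Tl (Var 0)))) p3) (Seq (Assign 0 (Var v)) p2)))"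
  let ?T = "\<lambda>x. 2 + (poly q1 (size (ea x)) + (1 + 1 + (5 + (poly q2 (size (ea x)) + poly ?q3 (size (ea x))))))"
  have q3: "poly q3 (size (enc_pair ea eb (x, y))) \<le> poly ?q3 (size (ea x))" if "o' x = Some y" for x y
    using implements_size[OF i(1), of x] that poly_mono_nat[of "size (enc_pair ea eb (x, y))"]
    by (simp add: poly_pcompose enc_pair_def)
  have *: "reach ?p s (?T x) (\<lambda>s'. s' 0 = ec (?r x) \<and> (\<forall>w\<ge>v + 1. s' w = s w))"
    if s: "s 0 = ea x" for s x
  proof -
    have 1: "reach (Seq (Assign 0 (Var v)) p2) s2 (5 + (poly q2 (size (ea x)) + poly ?q3 (size (ea x))))
        (\<lambda>s'. s' 0 = ec (?r x) \<and> (\<forall>w\<ge>v + 1. s' w = s2 w))"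
      if "s2 v = ea x" "o' x = None" for s2
      by (rule reach_mono, rule reach_Seq[of _ _ 2], rule reach_mono[OF reach_Assign],
          rule implements_run[OF i(2) _ order_refl]) (use that v in auto)
    have 2: "reach (Seq (Assign 0 (Node (Var v) (Tl (Var 0)))) p3) s2
          (5 + (poly q2 (size (ea x)) + poly ?q3 (size (ea x))))
        (\<lambda>s'. s' 0 = ec (?r x) \<and> (\<forall>w\<ge>v + 1. s' w = s2 w))"
      if "s2 v = ea x" "s2 0 = enc_option eb (Some y)" "o' x = Some y" for s2 y
      by (rule reach_mono, rule reach_Seq[of _ _ 5], rule reach_mono[OF reach_Assign],
          rule implements_run[OF i(3), of _ "(x, y)", OF _ q3]) (use that v in \<open>auto simp: enc_pair_def\<close>)
    show ?thesis
    proof (rule reach_mono, rule reach_Assign_Seq, rule reach_Seq,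
        rule implements_run[OF i(1) _ order_refl])
      let ?s = "s(v := expr_val (Var 0) s)"
      show "?s 0 = ea x" using s v by simp
      fix s1 assume s1: "s1 0 = enc_option eb (o' x)" "\<And>w. w \<ge> m1 \<Longrightarrow> s1 w = ?s w"
      then have "s1 v = ea x" "\<And>w. w \<ge> v + 1 \<Longrightarrow> s1 w = s w" using s v by auto
      then show "reach (If (Var 0) (Seq (Assign 0 (Node (Var v) (Tl (Var 0)))) p3) (Seq (Assign 0 (Var v)) p2)) s1
          (expr_cost (Var 0) + 1 + (5 + (poly q2 (size (ea x)) + poly ?q3 (size (ea x)))))
          (\<lambda>s'. s' 0 = ec (?r x) \<and> (\<forall>w\<ge>v + 1. s' w = s w))"
        using s1(1) by (intro reach_If; cases "o' x") (auto intro: reach_mono[OF 1] reach_mono[OF 2])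
    qed auto
  qed
  have "implements ?p (v + 1) ([:9:] + q1 + q2 + ?q3) ea ec ?r"
    unfolding implements_def poly_add
  proof (intro allI conjI impI)
    fix x
    have "size (ec (?r x)) \<le> poly q2 (size (ea x)) + poly ?q3 (size (ea x))"
    proof (cases "o' x")
      case None
      then show ?thesis using implements_size[OF i(2), of x] by simp
    next
      case (Some y)
      then show ?thesis using implements_size[OF i(3), of "(x, y)"] q3[OF Some] by simp
    qed
    then show "size (ec (?r x)) \<le> poly [:9:] (size (ea x)) + poly q1 (size (ea x)) +
        poly q2 (size (ea x)) + poly ?q3 (size (ea x))"
      by simp
    fix s :: store assume "s 0 = ea x"
    from *[where s = s and x = x, OF this] show "reach ?p s (poly [:9:] (size (ea x)) + poly q1 (size (ea x)) +
        poly q2 (size (ea x)) + poly ?q3 (size (ea x)))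
        (\<lambda>s'. s' 0 = ec (?r x) \<and> (\<forall>w\<ge>v + 1. s' w = s w))"
      by (rule reach_mono) auto
  qed
  then show ?thesis by (auto simp: poly_time_def)
qed

lemma size_enc_list_append:
  "size (enc_list e (xs @ ys)) = size (enc_list e xs) + size (enc_list e ys)"
  by (induction xs) auto

lemma length_le_size_enc_list: "length xs \<le> size (enc_list e xs)"
  by (induction xs) auto

text \<open>The loop keeps the parameter in \<open>v\<close>, the remaining list in
  \<open>Suc v\<close> and the state after \<open>pre\<close> in variable 0. Since \<open>K\<close>
  bounds every intermediate state, \<open>B\<close> bounds each run of \<open>p\<close>. A round
  adds 2 for the test and 7 and 3 for the assignments, that is \<open>B + 12\<close>; the failing
  test costs the final 2.\<close>

lemma fold_loop:
  assumes p: "implements p m q (enc_pair ea (enc_pair eb es)) es (\<lambda>z. f (fst z) (fst (snd z)) (snd (snd z)))"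
    and v: "v = Suc m"
    and K: "\<And>pre suf. l0 = pre @ suf \<Longrightarrow> size (es (fold (f x) pre st)) \<le> K"
    and B: "poly q (size (ea x) + size (enc_list eb l0) + K + 2) \<le> B"
    and l0: "l0 = pre @ l"
    and s: "s 0 = es (fold (f x) pre st)" "s v = ea x" "s (Suc v) = enc_list eb l"
  shows "reach (While (Var (Suc v)) (Seq (Assign 0 (Node (Var v) (Node (Hd (Var (Suc v))) (Var 0))))
      (Seq p (Assign (Suc v) (Tl (Var (Suc v))))))) s (length l * (B + 12) + 2)
    (\<lambda>s'. s' 0 = es (fold (f x) l0 st) \<and> (\<forall>w\<ge>v + 2. s' w = s w))"
  using l0 s
proof (induction l arbitrary: pre s)
  case Nil
  then show ?case by (intro reach_mono[OF reach_WhileFalse]) auto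
next
  case (Cons b l)
  let ?w = "While (Var (Suc v)) (Seq (Assign 0 (Node (Var v) (Node (Hd (Var (Suc v))) (Var 0))))
      (Seq p (Assign (Suc v) (Tl (Var (Suc v))))))"
  let ?st = "fold (f x) pre st"
  have "size (enc_pair ea (enc_pair eb es) (x, b, ?st)) \<le> size (ea x) + size (enc_list eb l0) + K + 2"
    using K[OF Cons.prems(1)] by (simp add: enc_pair_def Cons.prems(1) size_enc_list_append)
  then have b: "poly q (size (enc_pair ea (enc_pair eb es) (x, b, ?st))) \<le> B"
    using poly_mono_nat B le_trans by blast
  have IH: "reach ?w s2 (length l * (B + 12) + 2)
      (\<lambda>s'. s' 0 = es (fold (f x) l0 st) \<and> (\<forall>w\<ge>v + 2. s' w = s w))"
    if "s2 0 = es (f x b ?st)" "s2 v = ea x" "s2 (Suc v) = enc_list eb l" "\<And>w. w \<ge> v + 2 \<Longrightarrow> s2 w = s w" for s2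
    by (rule reach_mono[OF Cons.IH[of "pre @ [b]"]]) (use that Cons.prems in auto)
  have "reach (Seq (Assign 0 (Node (Var v) (Node (Hd (Var (Suc v))) (Var 0))))
      (Seq p (Assign (Suc v) (Tl (Var (Suc v)))))) s (6 + 1 + (B + (2 + 1)))
      (\<lambda>s2. reach ?w s2 (length l * (B + 12) + 2)
        (\<lambda>s'. s' 0 = es (fold (f x) l0 st) \<and> (\<forall>w\<ge>v + 2. s' w = s w)))"
    by (rule reach_mono, rule reach_Assign_Seq, rule reach_Seq,
        rule implements_run[OF p, of _ "(x, b, ?st)", OF _ b],
        use Cons.prems in \<open>simp add: enc_pair_def v\<close>, rule reach_Assign, rule IH)
      (use Cons.prems v in auto)
  from reach_WhileTrue[OF _ this] show ?case
    using Cons.prems by (auto elim!: reach_mono)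
qed

text \<open>A polynomial-time step may double its state, so iterating it needs a separate growth
  bound. As \<open>r\<close> serves all lists, it also covers the states inside the loop, which are
  folds over prefixes.\<close>

lemma poly_time_fold_triple:
  assumes "poly_time (enc_pair ea (enc_pair eb es)) es (\<lambda>z. f (fst z) (fst (snd z)) (snd (snd z)))"
    and r: "\<And>x l s. size (es (fold (f x) l s)) \<le> poly r (size (ea x) + size (enc_list eb l) + size (es s))"
  shows "poly_time (enc_pair ea (enc_pair (enc_list eb) es)) es
    (\<lambda>z. fold (f (fst z)) (fst (snd z)) (snd (snd z)))" (is "poly_time ?e es ?f")
proof -
  obtain p m q where
    p: "implements p m q (enc_pair ea (enc_pair eb es)) es (\<lambda>z. f (fst z) (fst (snd z)) (snd (snd z)))"
    using assms(1) unfolding poly_time_def by blast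
  define v where "v = Suc m"
  let ?w = "While (Var (Suc v)) (Seq (Assign 0 (Node (Var v) (Node (Hd (Var (Suc v))) (Var 0))))
      (Seq p (Assign (Suc v) (Tl (Var (Suc v))))))"
  let ?p = "Seq (Assign v (Hd (Var 0))) (Seq (Assign (Suc v) (Hd (Tl (Var 0))))
      (Seq (Assign 0 (Tl (Tl (Var 0)))) ?w))"
  let ?q = "pcompose q ([:2, 1:] + r)"
  let ?Q = "[:13:] + [:0, 1:] * (?q + [:12:]) + r"
  have "implements ?p (v + 2) ?Q ?e es ?f"
    unfolding implements_def
  proof (intro allI conjI impI)
    fix z :: "'a \<times> 'b list \<times> 'c"
    obtain x l st where z: "z = (x, l, st)" by (cases z) auto
    let ?N = "size (?e z)"
    have N: "size (ea x) + size (enc_list eb l) + size (es st) \<le> ?N" by (simp add: z enc_pair_def)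
    have K: "size (es (fold (f x) pre st)) \<le> poly r ?N" if "l = pre @ suf" for pre suf
    proof (rule le_trans[OF r poly_mono_nat])
      show "size (ea x) + size (enc_list eb pre) + size (es st) \<le> ?N"
        using N that by (simp add: size_enc_list_append)
    qed
    then show "size (es (?f z)) \<le> poly ?Q ?N"
      using K[of l "[]"] by (simp add: z)
    have B: "poly q (size (ea x) + size (enc_list eb l) + poly r ?N + 2) \<le> poly ?q ?N"
    proof -
      have "poly q (size (ea x) + size (enc_list eb l) + poly r ?N + 2) \<le> poly q (2 + ?N + poly r ?N)"
        by (rule poly_mono_nat) (use N in linarith)
      then show ?thesis by (simp add: poly_pcompose)
    qed
    have "length l \<le> ?N" using N length_le_size_enc_list[of l eb] by simp
    then have len: "length l * (poly ?q ?N + 12) \<le> ?N * (poly ?q ?N + 12)" by (rule mult_le_mono1)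
    fix s :: store assume s: "s 0 = ?e z"
    have loop: "reach ?w s2 (length l * (poly ?q ?N + 12) + 2)
        (\<lambda>s'. s' 0 = es (?f z) \<and> (\<forall>w\<ge>v + 2. s' w = s w))"
      if "s2 0 = es st" "s2 v = ea x" "s2 (Suc v) = enc_list eb l" "\<And>w. w \<ge> v + 2 \<Longrightarrow> s2 w = s w" for s2
      by (rule reach_mono[OF fold_loop[OF p v_def K B, where pre = "[]" and l = l and s = s2]]) (use that z in auto)
    show "reach ?p s (poly ?Q ?N) (\<lambda>s'. s' 0 = es (?f z) \<and> (\<forall>w\<ge>v + 2. s' w = s w))"
    proof (rule reach_mono)
      show "reach ?p s (expr_cost (Hd (Var 0)) + 1 + (expr_cost (Hd (Tl (Var 0))) + 1 +
          (expr_cost (Tl (Tl (Var 0))) + 1 + (length l * (poly ?q ?N + 12) + 2))))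
          (\<lambda>s'. s' 0 = es (?f z) \<and> (\<forall>w\<ge>v + 2. s' w = s w))"
        by (intro reach_Assign_Seq loop) (use s z in \<open>auto simp: enc_pair_def v_def\<close>)
      show "expr_cost (Hd (Var 0)) + 1 + (expr_cost (Hd (Tl (Var 0))) + 1 +
          (expr_cost (Tl (Tl (Var 0))) + 1 + (length l * (poly ?q ?N + 12) + 2))) \<le> poly ?Q ?N"
        using len by (simp add: algebra_simps)
    qed
  qed
  then show ?thesis by (auto simp: poly_time_def)
qed

lemma poly_time_fold:
  assumes "poly_time ea (enc_list eb) l" "poly_time ea es s"
    "poly_time (enc_pair ea (enc_pair eb es)) es (\<lambda>z. f (fst z) (fst (snd z)) (snd (snd z)))"
    "\<And>x l s. size (es (fold (f x) l s)) \<le> poly r (size (ea x) + size (enc_list eb l) + size (es s))"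
  shows "poly_time ea es (\<lambda>x. fold (f x) (l x) (s x))"
  using poly_time_comp[OF poly_time_pair[OF poly_time_id poly_time_pair[OF assms(1,2)]]
      poly_time_fold_triple[OF assms(3,4)]]
  by simp

section \<open>Constructors, Booleans and unary arithmetic\<close>

lemma poly_time_fst: "poly_time ea (enc_pair eb ec) f \<Longrightarrow> poly_time ea eb (\<lambda>x. fst (f x))"
  by (rule poly_time_comp, assumption, rule poly_time_expr[of _ "Hd (Var 0)" _ _ 0])
    (auto simp: enc_pair_def)

lemma poly_time_snd: "poly_time ea (enc_pair eb ec) f \<Longrightarrow> poly_time ea ec (\<lambda>x. snd (f x))"
  by (rule poly_time_comp, assumption, rule poly_time_expr[of _ "Tl (Var 0)" _ _ 0])
    (auto simp: enc_pair_def)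

lemma poly_time_Cons:
  "poly_time ea eb f \<Longrightarrow> poly_time ea (enc_list eb) g \<Longrightarrow> poly_time ea (enc_list eb) (\<lambda>x. f x # g x)"
  by (rule poly_time_recode[OF poly_time_pair[of ea eb f "enc_list eb" g]]) (auto simp: enc_pair_def)

lemma poly_time_Some: "poly_time ea eb f \<Longrightarrow> poly_time ea (enc_option eb) (\<lambda>x. Some (f x))"
  by (rule poly_time_comp, assumption, rule poly_time_expr[of _ "Node Empty (Var 0)" _ _ 1]) auto

lemma poly_time_Suc: "poly_time ea enc_nat f \<Longrightarrow> poly_time ea enc_nat (\<lambda>x. Suc (f x))"
  by (rule poly_time_comp, assumption, rule poly_time_expr[of _ "Node Empty (Var 0)" _ _ 1]) auto

lemma poly_time_If:
  assumes "poly_time ea enc_bool b" "poly_time ea eb f" "poly_time ea eb g"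
  shows "poly_time ea eb (\<lambda>x. if b x then f x else g x)"
proof -
  \<comment> \<open>A Boolean has the same code as an optional unit value, so branching is an
    instance of \<open>poly_time_case\<close>.\<close>
  have "poly_time ea (enc_option (\<lambda>_ :: unit. Leaf)) (\<lambda>x. if b x then Some () else None)"
    by (rule poly_time_recode[OF assms(1)]) (simp add: enc_bool_def)
  moreover have "poly_time (enc_pair ea (\<lambda>_ :: unit. Leaf)) eb (\<lambda>z. f (fst z))"
    by (rule poly_time_comp[OF poly_time_fst[OF poly_time_id] assms(2)])
  ultimately have "poly_time ea eb
      (\<lambda>x. case if b x then Some () else None of None \<Rightarrow> g x | Some _ \<Rightarrow> f x)"
    by (rule poly_time_case[OF _ assms(3)])
  then show ?thesis by (rule poly_time_recode) simp
qed

lemma poly_time_conj: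
  assumes "poly_time ea enc_bool f" "poly_time ea enc_bool g"
  shows "poly_time ea enc_bool (\<lambda>x. f x \<and> g x)"
  by (rule poly_time_recode[OF poly_time_If[OF assms poly_time_const[of _ _ False]]]) simp

lemma poly_time_not: "poly_time ea enc_bool f \<Longrightarrow> poly_time ea enc_bool (\<lambda>x. \<not> f x)"
  by (rule poly_time_recode[OF poly_time_If[of ea f enc_bool "\<lambda>_. False" "\<lambda>_. True"]])
    (simp_all add: poly_time_const)

lemma poly_time_is_0:
  assumes "poly_time ea enc_nat f" shows "poly_time ea enc_bool (\<lambda>x. f x = 0)"
proof -
  \<comment> \<open>In unary, a number is coded like the option of its predecessor, with 0 as
    \<open>None\<close>.\<close>
  have "enc_option enc_nat (if n = 0 then None else Some (n - 1)) = enc_nat n" for n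
    by (cases n) auto
  then have "poly_time ea (enc_option enc_nat) (\<lambda>x. if f x = 0 then None else Some (f x - 1))"
    by (intro poly_time_recode[OF assms])
  from poly_time_case[OF this poly_time_const poly_time_const, of enc_bool True False]
  show ?thesis by (rule poly_time_recode) (simp add: enc_bool_def)
qed

lemma poly_time_is_None:
  assumes "poly_time ea (enc_option eb) f" shows "poly_time ea enc_bool (\<lambda>x. f x = None)"
  using poly_time_case[OF assms poly_time_const poly_time_const, of enc_bool True False]
  by (rule poly_time_recode) (simp split: option.split)

lemmas poly_time_basic = poly_time_fst poly_time_snd poly_time_Cons poly_time_Some poly_time_Suc
  poly_time_If poly_time_conj poly_time_not poly_time_is_None poly_time_id poly_time_const

lemma size_enc_nat: "size (enc_nat n) = n"
  by (induction n) auto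

lemma right_enc_nat: "right (enc_nat n) = enc_nat (n - 1)"
  by (cases n) auto

lemma poly_time_minus:
  assumes "poly_time ea enc_nat f" "poly_time ea enc_nat g"
  shows "poly_time ea enc_nat (\<lambda>x. f x - g x)"
proof -
  \<comment> \<open>A unary number is also a list of units; it drives a loop that
    decrements.\<close>
  have u: "enc_list (\<lambda>_ :: unit. Leaf) (replicate n ()) = enc_nat n" for n
    by (induction n) auto
  have "poly_time ea (enc_list (\<lambda>_ :: unit. Leaf)) (\<lambda>x. replicate (g x) ())"
    by (rule poly_time_recode[OF assms(2)]) (simp add: u)
  moreover have p: "poly_time (enc_pair ea (enc_pair (\<lambda>_ :: unit. Leaf) enc_nat)) enc_nat
      (\<lambda>z. snd (snd z) - 1)"
    by (rule poly_time_comp[OF poly_time_snd[OF poly_time_snd[OF poly_time_id]]],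
        rule poly_time_expr[of _ "Tl (Var 0)" _ _ 0])
      (auto simp: size_enc_nat right_enc_nat)
  moreover have fold: "fold (\<lambda>_ n. n - 1) l n = n - length l" for l :: "unit list" and n :: nat
    by (induction l arbitrary: n) auto
  ultimately have "poly_time ea enc_nat (\<lambda>x. fold (\<lambda>_ n. n - 1) (replicate (g x) ()) (f x))"
    using assms(1) by (intro poly_time_fold[where r = "[:0, 1:]"]) (auto simp: size_enc_nat)
  then show ?thesis by (simp only: fold length_replicate)
qed

lemma poly_time_eq:
  assumes "poly_time ea enc_nat f" "poly_time ea enc_nat g"
  shows "poly_time ea enc_bool (\<lambda>x. f x = g x)"
  by (rule poly_time_recode[OF poly_time_conj[OF poly_time_is_0[OF poly_time_minus[OF assms]]
      poly_time_is_0[OF poly_time_minus[OF assms(2,1)]]]]) (simp add: enc_bool_def)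

section \<open>List functions by accumulation and reversal\<close>

lemma poly_time_rev:
  assumes "poly_time ea (enc_list eb) f" shows "poly_time ea (enc_list eb) (\<lambda>x. rev (f x))"
proof -
  have s: "size (enc_list eb (fold (#) l a)) = size (enc_list eb l) + size (enc_list eb a)" for l a
    by (induction l arbitrary: a) auto
  have "poly_time ea (enc_list eb) (\<lambda>x. fold (#) (f x) [])"
    by (rule poly_time_fold[where r = "[:0, 1:]"], rule assms, rule poly_time_const,
        (rule poly_time_basic)+) (simp add: s)
  then show ?thesis by (simp add: fold_Cons_rev)
qed

lemma poly_time_filter:
  assumes "poly_time ea (enc_list eb) l" "poly_time (enc_pair ea eb) enc_bool (\<lambda>z. P (fst z) (snd z))"
  shows "poly_time ea (enc_list eb) (\<lambda>x. filter (P x) (l x))"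
proof -
  have f: "fold (\<lambda>b a. if P x b then b # a else a) l a = rev (filter (P x) l) @ a" for x l a
    by (induction l arbitrary: a) auto
  have s: "size (enc_list eb (fold (\<lambda>b a. if P x b then b # a else a) l a))
      \<le> size (enc_list eb l) + size (enc_list eb a)" for x l a
  proof (induction l arbitrary: a)
    case (Cons b l)
    show ?case using Cons.IH[of a] Cons.IH[of "b # a"] by simp
  qed simp
  have "poly_time (enc_pair ea (enc_pair eb (enc_list eb))) enc_bool (\<lambda>z. P (fst z) (fst (snd z)))"
    using poly_time_comp[OF poly_time_pair[OF poly_time_fst[OF poly_time_id]
          poly_time_fst[OF poly_time_snd[OF poly_time_id]]] assms(2)] by simp
  then have "poly_time ea (enc_list eb) (\<lambda>x. fold (\<lambda>b a. if P x b then b # a else a) (l x) [])"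
    by - (rule poly_time_fold[where r = "[:0, 1:]"], rule assms, rule poly_time_const,
        (assumption | rule poly_time_basic)+, simp add: le_trans[OF s])
  then have "poly_time ea (enc_list eb) (\<lambda>x. rev (fold (\<lambda>b a. if P x b then b # a else a) (l x) []))"
    by (rule poly_time_rev)
  then show ?thesis by (simp add: f)
qed

lemma poly_time_map:
  assumes "poly_time ea (enc_list eb) l" "poly_time (enc_pair ea eb) ec (\<lambda>z. g (fst z) (snd z))"
  shows "poly_time ea (enc_list ec) (\<lambda>x. map (g x) (l x))"
proof -
  obtain q where q: "size (ec (g x b)) \<le> poly q (size (enc_pair ea eb (x, b)))" for x b
    using assms(2) unfolding poly_time_def implements_def by fastforce
  have f: "fold (\<lambda>b a. g x b # a) l a = rev (map (g x) l) @ a" for x l a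
    by (induction l arbitrary: a) auto
  \<comment> \<open>A fixed \<open>N\<close> above the size of the list keeps the bound per entry
    constant while the induction shortens the list.\<close>
  have s: "size (enc_list ec (fold (\<lambda>b a. g x b # a) l a))
      \<le> length l * (poly q (size (ea x) + N + 1) + 1) + size (enc_list ec a)"
    if "size (enc_list eb l) \<le> N" for x l a N
    using that
  proof (induction l arbitrary: a)
    case (Cons b l)
    have "size (ec (g x b)) \<le> poly q (size (ea x) + N + 1)"
      by (rule le_trans[OF q poly_mono_nat]) (use Cons.prems in \<open>simp add: enc_pair_def\<close>)
    then show ?case using Cons.IH[of "g x b # a"] Cons.prems by (simp add: f)
  qed simp
  have "poly_time ea (enc_list ec) (\<lambda>x. fold (\<lambda>b a. g x b # a) (l x) [])"
  proof (rule poly_time_fold[where r = "[:0, 1:] * (pcompose q [:1, 1:] + 1) + [:0, 1:]"],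
      rule assms, rule poly_time_const, rule poly_time_Cons)
    show "poly_time (enc_pair ea (enc_pair eb (enc_list ec))) ec (\<lambda>z. g (fst z) (fst (snd z)))"
      using poly_time_comp[OF poly_time_pair[OF poly_time_fst[OF poly_time_id]
          poly_time_fst[OF poly_time_snd[OF poly_time_id]]] assms(2)] by simp
    show "poly_time (enc_pair ea (enc_pair eb (enc_list ec))) (enc_list ec) (\<lambda>z. snd (snd z))"
      by (rule poly_time_basic)+
    fix x l s'
    let ?N = "size (ea x) + size (enc_list eb l) + size (enc_list ec s')"
    have "length l * (poly q (size (ea x) + size (enc_list eb l) + 1) + 1) \<le> ?N * (poly q (?N + 1) + 1)"
    proof (rule mult_le_mono)
      show "length l \<le> ?N" using length_le_size_enc_list[of l eb] by simp
      show "poly q (size (ea x) + size (enc_list eb l) + 1) + 1 \<le> poly q (?N + 1) + 1"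
        by (rule add_right_mono, rule poly_mono_nat) simp
    qed
    then show "size (enc_list ec (fold (\<lambda>b a. g x b # a) l s'))
        \<le> poly ([:0, 1:] * (pcompose q [:1, 1:] + 1) + [:0, 1:]) ?N"
      using s[OF order_refl, of x l s'] by (simp add: poly_pcompose)
  qed
  then have "poly_time ea (enc_list ec) (\<lambda>x. rev (fold (\<lambda>b a. g x b # a) (l x) []))"
    by (rule poly_time_rev)
  then show ?thesis by (simp add: f)
qed

section \<open>The algorithm\<close>

text \<open>A table is stored as a list of ordered pairs in which the entries of each agent appear from
  best to worst.\<close>

definition last_of :: "('a \<times> 'a) list \<Rightarrow> 'a \<Rightarrow> 'a option" where
  "last_of T i = fold (\<lambda>e s. if fst e = i then Some (snd e) else s) T None"

definition first_of :: "('a \<times> 'a) list \<Rightarrow> 'a \<Rightarrow> 'a option" where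
  "first_of T i = last_of (rev T) i"

definition drop_pair :: "'a \<Rightarrow> 'a \<Rightarrow> ('a \<times> 'a) list \<Rightarrow> ('a \<times> 'a) list" where
  "drop_pair a b T = filter (\<lambda>e. \<not> (fst e = a \<and> snd e = b) \<and> \<not> (fst e = b \<and> snd e = a)) T"

definition propose :: "'a \<Rightarrow> ('a \<times> 'a) list \<Rightarrow> ('a \<times> 'a) list" where
  "propose i T = (case first_of T i of None \<Rightarrow> T | Some j \<Rightarrow>
     (case last_of T j of None \<Rightarrow> T | Some k \<Rightarrow> if k = i then T else drop_pair j k T))"

text \<open>In the following, the list \<open>K\<close> only serves as a counter that bounds the number of passes.\<close>

definition proposals :: "'a list \<Rightarrow> 'b list \<Rightarrow> ('a \<times> 'a) list \<Rightarrow> ('a \<times> 'a) list" where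
  "proposals V K T = fold (\<lambda>_. fold propose V) K T"

text \<open>\<open>z = y\<close> means that the list of \<open>x\<close> has a single entry, which
  must not be cut.\<close>

definition cut_first :: "'a list \<Rightarrow> 'b list \<Rightarrow> 'a \<Rightarrow> ('a \<times> 'a) list \<Rightarrow> ('a \<times> 'a) list" where
  "cut_first V K x T = (case first_of T x of None \<Rightarrow> T | Some y \<Rightarrow>
     (case last_of T x of None \<Rightarrow> T | Some z \<Rightarrow>
        if z = y then T else proposals V K (drop_pair x y T)))"

definition safe_cut :: "'a list \<Rightarrow> 'b list \<Rightarrow> 'a \<Rightarrow> ('a \<times> 'a) list \<Rightarrow> ('a \<times> 'a) list" where
  "safe_cut V K x T = (case first_of T x of None \<Rightarrow> T | Some y \<Rightarrow>
     if last_of (cut_first V K x T) y = None then T else cut_first V K x T)"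

text \<open>The initial \<open>T\<close> is a long enough counter throughout: every pass that
  changes a table shortens it. At the end one round of \<open>cut_first\<close> is enough, since a
  cut leaves at most one of the two entries of \<open>x\<close> and tables only shrink.\<close>

definition final_table :: "'a list \<Rightarrow> ('a \<times> 'a) list \<Rightarrow> ('a \<times> 'a) list" where
  "final_table V T =
     fold (cut_first V T) V (fold (\<lambda>_. fold (safe_cut V T) V) T (proposals V T T))"

lemma last_of_snoc: "last_of (T @ [e]) i = (if fst e = i then Some (snd e) else last_of T i)"
  by (simp add: last_of_def)

lemma first_of_Nil: "first_of [] i = None"
  by (simp add: first_of_def last_of_def)

lemma first_of_Cons: "first_of (e # T) i = (if fst e = i then Some (snd e) else first_of T i)"
  by (simp add: first_of_def last_of_snoc)

lemma last_of_None: "last_of T i = None \<longleftrightarrow> (\<forall>j. (i, j) \<notin> set T)"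
  by (induction T rule: rev_induct) (auto simp: last_of_snoc, simp_all add: last_of_def)

lemma first_of_None: "first_of T i = None \<longleftrightarrow> (\<forall>j. (i, j) \<notin> set T)"
  by (simp add: first_of_def last_of_None)

lemma last_of_in: "last_of T i = Some j \<Longrightarrow> (i, j) \<in> set T"
  by (induction T rule: rev_induct) (auto simp: last_of_snoc last_of_def[of "[]"] split: if_splits)

lemma first_of_in: "first_of T i = Some j \<Longrightarrow> (i, j) \<in> set T"
  using last_of_in[of "rev T"] by (simp add: first_of_def)

lemma length_drop_pair: "(a, b) \<in> set T \<Longrightarrow> length (drop_pair a b T) < length T"
  unfolding drop_pair_def by (rule length_filter_less) auto

section \<open>Fixed points of shrinking steps\<close>

definition shrinking :: "('b \<Rightarrow> 'a list \<Rightarrow> 'a list) \<Rightarrow> bool" where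
  "shrinking f \<longleftrightarrow> (\<forall>i T. f i T = T \<or> length (f i T) < length T)"

lemma shrinking_fold:
  assumes "shrinking f"
  shows "(fold f V T = T \<and> (\<forall>i \<in> set V. f i T = T)) \<or> length (fold f V T) < length T"
proof (induction V arbitrary: T)
  case (Cons v V)
  consider "f v T = T" | "length (f v T) < length T"
    using assms unfolding shrinking_def by blast
  then show ?case
  proof cases
    case 1
    then show ?thesis using Cons.IH[of T] by simp
  next
    case 2
    then show ?thesis using Cons.IH[of "f v T"] by auto
  qed
qed simp

text \<open>A pass that does not shorten the table left it alone at every single step, so every
  \<open>f i\<close> fixes it. Any other pass pays for one element of \<open>K\<close> with a unit
  of length.\<close>

lemma shrinking_passes:
  assumes "shrinking f" "length T \<le> length K" "i \<in> set V"
  shows "f i (fold (\<lambda>_. fold f V) K T) = fold (\<lambda>_. fold f V) K T"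
  using assms(2)
proof (induction K arbitrary: T)
  case Nil
  then have "T = []" by simp
  moreover have "f i [] = []" using assms(1) unfolding shrinking_def by fastforce
  ultimately show ?case by simp
next
  case (Cons k K)
  consider "fold f V T = T" "f i T = T" | "length (fold f V T) < length T"
    using shrinking_fold[OF assms(1), of V T] assms(3) by blast
  then show ?case
  proof cases
    case 1
    have "fold (\<lambda>_. fold f V) K T = T" by (induction K) (simp_all add: 1)
    then show ?thesis using 1 by simp
  next
    case 2
    then show ?thesis using Cons by simp
  qed
qed

lemma shrinking_propose: "shrinking propose"
  unfolding shrinking_def propose_def
  by (auto split: option.split dest!: last_of_in intro: length_drop_pair)

lemma shrinking_proposals: "proposals V K T = T \<or> length (proposals V K T) < length T"
proof -
  have "shrinking (\<lambda>_ :: 'c. fold propose V)"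
    using shrinking_fold[OF shrinking_propose] unfolding shrinking_def by blast
  from shrinking_fold[OF this, of K T] show ?thesis unfolding proposals_def by blast
qed

lemma length_cut_proposals:
  assumes "(x, y) \<in> set T" shows "length (proposals V K (drop_pair x y T)) < length T"
  using length_drop_pair[OF assms] shrinking_proposals[of V K "drop_pair x y T"] by auto

lemma shrinking_cut_first: "shrinking (cut_first V K)"
  unfolding shrinking_def cut_first_def
  by (auto split: option.split dest!: first_of_in intro: length_cut_proposals)

lemma shrinking_safe_cut: "shrinking (safe_cut V K)"
  using shrinking_cut_first[of V K] unfolding shrinking_def safe_cut_def
  by (auto split: option.split)

section \<open>Correctness of the algorithm on lists\<close>

context ranking
begin

definition ordered :: "('a \<times> 'a) list \<Rightarrow> bool" where
  "ordered T \<longleftrightarrow>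
     sorted_wrt (\<lambda>e e'. fst e = fst e' \<longrightarrow> pr (fst e) (snd e) < pr (fst e) (snd e')) T"

lemma last_of_worst: "ordered T \<Longrightarrow> last_of T i = Some j \<Longrightarrow> worst (set T) i j"
proof (induction T rule: rev_induct)
  case Nil
  then show ?case by (simp add: last_of_def)
next
  case (snoc e T)
  obtain a b where "e = (a, b)" by (cases e)
  with snoc show ?case
    by (auto simp: ordered_def sorted_wrt_append last_of_snoc worst_def split: if_splits)
qed

lemma first_of_best: "ordered T \<Longrightarrow> first_of T i = Some j \<Longrightarrow> best (set T) i j"
proof (induction T)
  case Nil
  then show ?case by (simp add: first_of_Nil)
next
  case (Cons e T)
  obtain a b where "e = (a, b)" by (cases e)
  with Cons show ?case
    by (auto simp: ordered_def first_of_Cons best_def split: if_splits)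
qed

lemma first_of_iff:
  assumes "ordered T" "table (set T)" shows "first_of T i = Some j \<longleftrightarrow> best (set T) i j"
proof
  assume b: "best (set T) i j"
  then obtain k where "first_of T i = Some k"
    using bestD(1) first_of_None by (metis not_None_eq)
  then show "first_of T i = Some j"
    using best_unique[OF assms(2) b] first_of_best[OF assms(1)] by blast
qed (rule first_of_best[OF assms(1)])

lemma set_drop_pair: "set (drop_pair a b T) = cut a b (set T)"
  by (auto simp: drop_pair_def cut_def)

lemma ordered_drop_pair: "ordered T \<Longrightarrow> ordered (drop_pair a b T)"
  by (simp add: ordered_def drop_pair_def sorted_wrt_filter)

lemma propose_rejection:
  assumes "ordered T" "table (set T)"
  shows "ordered (propose i T)" "rejection\<^sup>*\<^sup>* (set T) (set (propose i T))"
proof -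
  have "propose i T = T \<or> (\<exists>j k. first_of T i = Some j \<and> last_of T j = Some k \<and> k \<noteq> i \<and>
      propose i T = drop_pair j k T)"
    unfolding propose_def by (auto split: option.split)
  then consider "propose i T = T" | j k where "best (set T) i j" "worst (set T) j k" "k \<noteq> i"
      "propose i T = drop_pair j k T"
    using first_of_best[OF assms(1)] last_of_worst[OF assms(1)] by blast
  then show "ordered (propose i T)" "rejection\<^sup>*\<^sup>* (set T) (set (propose i T))"
    unfolding atomize_conj
  proof cases
    case 2
    then have "rejection (set T) (set (propose i T))"
      unfolding rejection_def set_drop_pair by (auto simp: set_drop_pair)
    then show "ordered (propose i T) \<and> rejection\<^sup>*\<^sup>* (set T) (set (propose i T))"
      using 2(4) ordered_drop_pair[OF assms(1)] by simp
  qed (use assms in simp)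
qed

lemma proposals_rejection:
  assumes "ordered T" "table (set T)"
  shows "ordered (proposals L K T) \<and> rejection\<^sup>*\<^sup>* (set T) (set (proposals L K T))"
proof -
  let ?P = "\<lambda>T'. ordered T' \<and> rejection\<^sup>*\<^sup>* (set T) (set T')"
  have step: "?P (propose i T')" if P: "?P T'" for i T'
  proof -
    have "table (set T')" using rejections_table assms(2) P by blast
    then show ?thesis using propose_rejection[of T' i] P by (meson rtranclp_trans)
  qed
  have "?P (fold (\<lambda>_. fold propose L) K T)"
    by (rule fold_invariant[where Q = "\<lambda>_. True"], simp, simp add: assms,
        rule fold_invariant[where Q = "\<lambda>_. True"]) (use step in simp_all)
  then show ?thesis by (simp add: proposals_def)
qed

text \<open>The counter is long enough for a fixed point of \<open>propose\<close>. There, a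
  proposer not last on the list of its favourite would still trigger \<open>drop_pair\<close>, which
  strictly shortens the table.\<close>

lemma proposals_balanced:
  assumes "ordered T" "table (set T)" "set L = V" "length T \<le> length K"
  shows "balanced (set (proposals L K T))"
  unfolding balanced_def
proof (intro conjI allI impI)
  let ?T = "proposals L K T"
  have o: "ordered ?T" and r: "rejection\<^sup>*\<^sup>* (set T) (set ?T)"
    using proposals_rejection[OF assms(1,2)] by auto
  show t: "table (set ?T)" using rejections_table[OF r assms(2)] by blast
  fix i j assume b: "best (set ?T) i j"
  have ji: "(j, i) \<in> set ?T" using bestD(1)[OF b] tableD[OF t] by blast
  then obtain k where k: "last_of ?T j = Some k" using last_of_None by (metis not_None_eq)
  have "i \<in> V" using bestD(1)[OF b] table_E[OF t] E_sub by blast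
  then have fix_i: "propose i ?T = ?T"
    using shrinking_passes[OF shrinking_propose assms(4)] assms(3) unfolding proposals_def by blast
  have "k = i"
  proof (rule ccontr)
    assume "k \<noteq> i"
    then have "drop_pair j k ?T = ?T"
      using fix_i k first_of_iff[OF o t, of i j] b by (simp add: propose_def)
    then show False using length_drop_pair[OF last_of_in[OF k]] by simp
  qed
  then show "worst (set ?T) j i" using last_of_worst[OF o k] by simp
qed

definition good_table :: "('a \<times> 'a) list \<Rightarrow> 'a set \<Rightarrow> bool" where
  "good_table T R \<longleftrightarrow> ordered T \<and> settled (set T) R"

lemma good_table_D: "good_table T R \<Longrightarrow> ordered T" "good_table T R \<Longrightarrow> settled (set T) R"
  "good_table T R \<Longrightarrow> balanced (set T)" "good_table T R \<Longrightarrow> table (set T)"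
  by (auto simp: good_table_def settled_def balanced_def)

lemma cut_first_cases:
  assumes "good_table T R" "set L = V" "length T \<le> length K"
  obtains (same) "cut_first L K x T = T" "\<And>j k. (x, j) \<in> set T \<Longrightarrow> (x, k) \<in> set T \<Longrightarrow> j = k"
  | (cut) y where "first_of T x = Some y" "best (set T) x y" "x \<notin> single (set T)"
      "rejection\<^sup>*\<^sup>* (cut x y (set T)) (set (cut_first L K x T))" "balanced (set (cut_first L K x T))"
      "good_table (cut_first L K x T) (if y \<in> active (set (cut_first L K x T)) then R else insert y R)"
      "length (cut_first L K x T) < length T"
proof -
  note o = good_table_D(1)[OF assms(1)] and t = good_table_D(4)[OF assms(1)]
    and bal = good_table_D(3)[OF assms(1)]
  show ?thesis
  proof (cases "first_of T x")
    case None
    show ?thesis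
      by (rule same, simp add: cut_first_def None) (use None in \<open>simp add: first_of_None\<close>)
  next
    case (Some y)
    have b: "best (set T) x y" using Some first_of_best[OF o] by blast
    obtain z where z: "last_of T x = Some z"
      using bestD(1)[OF b] last_of_None by (metis not_None_eq)
    have w: "worst (set T) x z" using z last_of_worst[OF o] by blast
    show ?thesis
    proof (cases "z = y")
      case True
      then show ?thesis
        using same Some z best_worst_single[OF t b] w by (auto simp: cut_first_def)
    next
      case False
      let ?T = "drop_pair x y T"
      have ns: "x \<notin> single (set T)"
        using False b w single_iff[OF t] best_unique[OF t] worst_unique[OF t] by metis
      have eq: "cut_first L K x T = proposals L K ?T"
        using Some z False by (simp add: cut_first_def)
      have o': "ordered ?T" and t': "table (set ?T)"
        using ordered_drop_pair[OF o] table_cut[OF t] by (auto simp: set_drop_pair)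
      have "length ?T \<le> length K"
        using length_drop_pair[OF bestD(1)[OF b]] assms(3) by simp
      then have bal': "balanced (set (cut_first L K x T))"
        unfolding eq by (rule proposals_balanced[OF o' t' assms(2)])
      have r: "ordered (cut_first L K x T)"
        "rejection\<^sup>*\<^sup>* (cut x y (set T)) (set (cut_first L K x T))"
        using proposals_rejection[OF o' t'] by (auto simp: eq set_drop_pair)
      have "settled (set (cut_first L K x T))
          (if y \<in> active (set (cut_first L K x T)) then R else insert y R)"
        by (rule cut_settled[OF bal b ns r(2) bal' good_table_D(2)[OF assms(1)]])
      then have "good_table (cut_first L K x T)
          (if y \<in> active (set (cut_first L K x T)) then R else insert y R)"
        using r(1) unfolding good_table_def by blast
      moreover have "length (cut_first L K x T) < length T"
        unfolding eq by (rule length_cut_proposals[OF bestD(1)[OF b]])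
      ultimately show ?thesis by (rule cut[OF Some b ns r(2) bal'])
    qed
  qed
qed

text \<open>\<open>R\<close> does not grow, because a cut is kept only if \<open>y\<close> is still
  active, and then \<open>cut_settled\<close> leaves \<open>R\<close> unchanged.\<close>

lemma safe_cut_good:
  assumes "good_table T R" "set L = V" "length T \<le> length K"
  shows "good_table (safe_cut L K x T) R" "length (safe_cut L K x T) \<le> length T"
proof -
  have "good_table (safe_cut L K x T) R \<and> length (safe_cut L K x T) \<le> length T"
    using assms(1,2,3)
  proof (cases rule: cut_first_cases[of T R L K x])
    case same
    then show ?thesis using assms(1) by (simp add: safe_cut_def split: option.split)
  next
    case (cut y)
    then show ?thesis
      using assms(1) by (auto simp: safe_cut_def last_of_None active_def split: if_splits)
  qed
  then show "good_table (safe_cut L K x T) R" "length (safe_cut L K x T) \<le> length T" by auto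
qed

definition two_per_row :: "('a \<times> 'a) set \<Rightarrow> bool" where
  "two_per_row T \<longleftrightarrow> (\<forall>i j. (i, j) \<in> T \<longrightarrow> best T i j \<or> worst T i j)"

lemma two_per_row_subset: "two_per_row T \<Longrightarrow> T' \<subseteq> T \<Longrightarrow> two_per_row T'"
  unfolding two_per_row_def using best_subset worst_subset by blast

text \<open>A row with a third entry would admit a cut after which \<open>y\<close> stays active.
  Such a cut is not undone, yet it shortens the table.\<close>

lemma safe_cut_fixpoint:
  assumes "good_table T R" "set L = V" "length T \<le> length K"
    and fixed: "\<And>x. x \<in> V \<Longrightarrow> safe_cut L K x T = T"
  shows "two_per_row (set T)"
  unfolding two_per_row_def
proof (rule ccontr)
  assume "\<not> (\<forall>i j. (i, j) \<in> set T \<longrightarrow> best (set T) i j \<or> worst (set T) i j)"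
  then obtain i j where "(i, j) \<in> set T" "\<not> best (set T) i j" "\<not> worst (set T) i j" by blast
  from safe_cut_exists[OF good_table_D(3)[OF assms(1)] this]
  obtain x y where xy: "best (set T) x y" "x \<notin> single (set T)"
    "\<And>T'. rejection\<^sup>*\<^sup>* (cut x y (set T)) T' \<Longrightarrow> y \<in> active T'"
    by blast
  have "x \<in> V" using bestD(1)[OF xy(1)] table_E[OF good_table_D(4)[OF assms(1)]] E_sub by blast
  then have f: "safe_cut L K x T = T" by (rule fixed)
  show False
    using assms(1,2,3)
  proof (cases rule: cut_first_cases[of T R L K x])
    case same
    then show False using xy(1,2) bestD(1)[OF xy(1)] unfolding single_def by blast
  next
    case (cut y')
    then have "y' = y" using best_unique[OF good_table_D(4)[OF assms(1)]] xy(1) by blast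
    then have "last_of (cut_first L K x T) y \<noteq> None"
      using xy(3) cut(4) by (auto simp: last_of_None active_def)
    then have "cut_first L K x T = T"
      using f cut(1) \<open>y' = y\<close> by (simp add: safe_cut_def split: if_splits)
    then show False using cut(7) by simp
  qed
qed

text \<open>The last conjunct is the account to be kept: two single agents for each agent in
  \<open>R\<close>.\<close>

definition nearly_done :: "('a \<times> 'a) list \<Rightarrow> 'a set \<Rightarrow> bool" where
  "nearly_done T R \<longleftrightarrow> good_table T R \<and> two_per_row (set T) \<and> R \<subseteq> V - active (set T) \<and>
     2 * card R \<le> card (single (set T))"

lemma nearly_done_cut_first:
  assumes "nearly_done T R" "set L = V" "length T \<le> length K"
  shows "\<exists>R'. nearly_done (cut_first L K x T) R' \<and> set (cut_first L K x T) \<subseteq> set T \<and>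
    length (cut_first L K x T) \<le> length T \<and>
    (\<forall>j k. (x, j) \<in> set (cut_first L K x T) \<longrightarrow> (x, k) \<in> set (cut_first L K x T) \<longrightarrow> j = k)"
proof -
  have good: "good_table T R" and two: "two_per_row (set T)" and R: "R \<subseteq> V - active (set T)"
    and card: "2 * card R \<le> card (single (set T))"
    using assms(1) unfolding nearly_done_def by auto
  note bal = good_table_D(3)[OF good] and t = good_table_D(4)[OF good]
  have finR: "finite R" using R finite_V by (meson Diff_subset finite_subset)
  show ?thesis
    using good assms(2,3)
  proof (cases rule: cut_first_cases[of T R L K x])
    case same
    then show ?thesis using assms(1) by auto
  next
    case (cut y)
    let ?T = "cut_first L K x T"
    let ?R = "if y \<in> active (set ?T) then R else insert y R"
    note c = bal cut(2,3,4,5)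
    have sub: "set ?T \<subseteq> set T" "(x, y) \<notin> set ?T" using cut_subset[OF c] by auto
    have t': "table (set ?T)" using cut(5) by (simp add: balanced_def)
    have "y \<in> V" using bestD(1)[OF cut(2)] table_E[OF t] E_sub by blast
    then have R': "?R \<subseteq> V - active (set ?T)" using R active_mono[OF sub(1)] by auto
    have fin: "finite (single (set ?T))" using finite_subset[OF single_active finite_active[OF t']] .
    have "2 * card ?R \<le> card (single (set ?T))"
    proof (cases "y \<in> active (set ?T)")
      case True
      then show ?thesis using card card_mono[OF fin cut_single_mono[OF c]] by simp
    next
      case False
      have "card (single (set T)) + 2 \<le> card (single (set ?T))"
        using cut_single_gain[OF c _ False] two unfolding two_per_row_def by blast
      then show ?thesis using False card card_insert_le_m1[of "card R + 1" R y]
        by (simp add: card_insert_if finR)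
    qed
    then have "nearly_done ?T ?R"
      using cut(6) two_per_row_subset[OF two sub(1)] R' unfolding nearly_done_def by blast
    moreover have "j = k" if "(x, j) \<in> set ?T" "(x, k) \<in> set ?T" for j k
    proof -
      \<comment> \<open>The first choice \<open>y\<close> of \<open>x\<close> has been cut, so with
        two entries per row only the last choice can remain.\<close>
      have "worst (set T) x l" if "(x, l) \<in> set ?T" for l
        using that two sub best_unique[OF t cut(2)] unfolding two_per_row_def by blast
      then show ?thesis using worst_unique[OF t] that by blast
    qed
    ultimately show ?thesis using sub(1) cut(7) by (meson less_imp_le)
  qed
qed

lemma nearly_done_fold:
  assumes "nearly_done T R" "set L = V" "length T \<le> length K"
  shows "\<exists>R'. nearly_done (fold (cut_first L K) xs T) R' \<and> set (fold (cut_first L K) xs T) \<subseteq> set T \<and>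
    (\<forall>x \<in> set xs. \<forall>j k. (x, j) \<in> set (fold (cut_first L K) xs T) \<longrightarrow>
      (x, k) \<in> set (fold (cut_first L K) xs T) \<longrightarrow> j = k)"
  using assms(1,3)
proof (induction xs arbitrary: T R)
  case (Cons x xs)
  let ?T1 = "cut_first L K x T"
  obtain R1 where R1: "nearly_done ?T1 R1" "set ?T1 \<subseteq> set T" "length ?T1 \<le> length T"
    "\<And>j k. (x, j) \<in> set ?T1 \<Longrightarrow> (x, k) \<in> set ?T1 \<Longrightarrow> j = k"
    using nearly_done_cut_first[OF Cons.prems(1) assms(2) Cons.prems(2), of x] by blast
  obtain R2 where "nearly_done (fold (cut_first L K) xs ?T1) R2"
    "set (fold (cut_first L K) xs ?T1) \<subseteq> set ?T1"
    "\<forall>x \<in> set xs. \<forall>j k. (x, j) \<in> set (fold (cut_first L K) xs ?T1) \<longrightarrow>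
      (x, k) \<in> set (fold (cut_first L K) xs ?T1) \<longrightarrow> j = k"
    using Cons.IH[OF R1(1)] R1(3) Cons.prems(2) le_trans by blast
  then show ?case using R1(2,4) by (intro exI[of _ R2]) (simp, blast)
qed auto

lemma final_table_correct:
  assumes "ordered T" "set T = E" "set L = V"
  obtains R where "good_table (final_table L T) R" "R \<subseteq> V" "3 * card R \<le> card V"
    "\<And>i j k. (i, j) \<in> set (final_table L T) \<Longrightarrow> (i, k) \<in> set (final_table L T) \<Longrightarrow> j = k"
proof -
  define T1 where "T1 = proposals L T T"
  define T2 where "T2 = fold (\<lambda>_. fold (safe_cut L T) L) T T1"
  have t: "table (set T)" using E_sym assms(2) by (auto simp: table_def)
  have r: "ordered T1" "rejection\<^sup>*\<^sup>* (set T) (set T1)"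
    using proposals_rejection[OF assms(1) t] by (auto simp: T1_def)
  have "balanced (set T1)"
    unfolding T1_def by (rule proposals_balanced[OF assms(1) t assms(3) order_refl])
  moreover have "dominated (set T1) i j \<or> dominated (set T1) j i" if "(i, j) \<in> E - set T1" for i j
    using rejections_deleted[OF r(2) t] that assms(2) by blast
  ultimately have g1: "good_table T1 {}"
    using r(1) unfolding good_table_def settled_def by blast
  have l1: "length T1 \<le> length T" using shrinking_proposals[of L T T] by (auto simp: T1_def)
  let ?P = "\<lambda>T'. good_table T' {} \<and> length T' \<le> length T"
  have step: "?P (safe_cut L T x T')" if "?P T'" for x T'
    using safe_cut_good[of T' "{}" L T x] that assms(3) by force
  have P2: "?P T2"
    unfolding T2_def
    by (rule fold_invariant[where Q = "\<lambda>_. True"], simp, simp add: g1 l1,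
        rule fold_invariant[where Q = "\<lambda>_. True"]) (use step in simp_all)
  have "safe_cut L T x T2 = T2" if "x \<in> V" for x
    unfolding T2_def by (rule shrinking_passes[OF shrinking_safe_cut l1]) (simp add: that assms(3))
  then have "two_per_row (set T2)" using safe_cut_fixpoint P2 assms(3) by blast
  then have "nearly_done T2 {}" using P2 by (simp add: nearly_done_def)
  from nearly_done_fold[OF this assms(3), of T L] P2
  obtain R where R: "nearly_done (final_table L T) R"
    "\<And>x j k. x \<in> V \<Longrightarrow> (x, j) \<in> set (final_table L T) \<Longrightarrow> (x, k) \<in> set (final_table L T) \<Longrightarrow> j = k"
    unfolding final_table_def T2_def T1_def assms(3) by blast
  let ?T = "set (final_table L T)"
  have g: "good_table (final_table L T) R" and RV: "R \<subseteq> V - active ?T" and c: "2 * card R \<le> card (single ?T)"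
    using R(1) unfolding nearly_done_def by auto
  have VE: "x \<in> V" if "(x, j) \<in> ?T" for x j
    using that table_E[OF good_table_D(4)[OF g]] E_sub by blast
  then have sV: "single ?T \<subseteq> V" unfolding single_def by blast
  \<comment> \<open>Single agents are active and those of \<open>R\<close> are not, so
    \<open>V\<close> has disjoint parts of sizes \<open>card R\<close> and at least
    \<open>2 * card R\<close>.\<close>
  have "R \<inter> single ?T = {}" using RV single_active by blast
  then have "card (R \<union> single ?T) = card R + card (single ?T)"
    using RV sV finite_V by (meson Diff_subset card_Un_disjoint finite_subset)
  moreover have "card (R \<union> single ?T) \<le> card V" using RV sV finite_V by (intro card_mono) auto
  ultimately have "3 * card R \<le> card V" using c by simp
  then show ?thesis using that g RV R(2) VE by blast
qed

end

subsection \<open>Counting the improving agents\<close>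

lemma partner_Some:
  assumes "matching N A M"
  shows "partner M i = Some j \<longleftrightarrow> {i, j} \<in> M"
proof -
  have unique: "j = k" if "{i, j} \<in> M" "{i, k} \<in> M" for j k
  proof -
    have "disjoint M" using assms by (simp add: matching_def)
    then have "{i, j} = {i, k}" using disjointD[OF _ that] by blast
    then show ?thesis by (auto simp: doubleton_eq_iff)
  qed
  show ?thesis
  proof
    assume "partner M i = Some j"
    then have ex: "\<exists>j. {i, j} \<in> M" and j: "j = (THE j. {i, j} \<in> M)"
      unfolding partner_def by (auto split: if_splits)
    then have "\<exists>!j. {i, j} \<in> M" using unique by blast
    then show "{i, j} \<in> M" unfolding j by (rule theI')
  next
    assume j: "{i, j} \<in> M"
    then have "(THE j. {i, j} \<in> M) = j" using unique by blast
    then show "partner M i = Some j" using j unfolding partner_def by auto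
  qed
qed

text \<open>At most \<open>|N - I|\<close> agents of \<open>I\<close> have their partner outside \<open>I\<close>, and at most \<open>2 |R|\<close> have
  their partner inside.\<close>

lemma card_improving:
  fixes f :: "'a \<Rightarrow> 'a"
  assumes "finite N" "I \<subseteq> N" "R \<subseteq> N" "f ` I \<subseteq> N" "\<And>i. i \<in> I \<Longrightarrow> f i \<in> I \<Longrightarrow> f (f i) = i"
    and "inj_on f I" and "\<And>i. i \<in> I \<Longrightarrow> f i \<in> I \<Longrightarrow> i \<in> R \<or> f i \<in> R"
  shows "2 * card I \<le> card N + 2 * card R"
proof -
  define I1 where "I1 = {i \<in> I. f i \<notin> I}"
  define I2 where "I2 = {i \<in> I. f i \<in> I}"
  have fin: "finite I" "finite R" using assms(1-3) finite_subset by blast+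
  have "card I1 = card (f ` I1)"
    using assms(6) by (intro card_image[symmetric]) (auto simp: I1_def inj_on_def)
  also have "\<dots> \<le> card (N - I)"
    using assms(1,4) by (intro card_mono) (auto simp: I1_def)
  also have "\<dots> = card N - card I" using assms(2) fin by (simp add: card_Diff_subset)
  finally have 1: "card I1 \<le> card N - card I" .
  \<comment> \<open>Every pair inside \<open>I\<close> meets \<open>R\<close>, so each of its
    members is in \<open>R\<close> or is the partner of a member of \<open>R\<close>.\<close>
  have "I2 \<subseteq> R \<union> f ` (R \<inter> I)"
  proof
    fix i assume "i \<in> I2"
    then have i: "i \<in> I" "f i \<in> I" by (auto simp: I2_def)
    then have "i = f (f i)" using assms(5) by simp
    then show "i \<in> R \<union> f ` (R \<inter> I)" using assms(7)[OF i] i by blast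
  qed
  then have "card I2 \<le> card (R \<union> f ` (R \<inter> I))" using fin by (intro card_mono) auto
  also have "\<dots> \<le> card R + card (f ` (R \<inter> I))" by (rule card_Un_le)
  also have "card (f ` (R \<inter> I)) \<le> card (R \<inter> I)" using fin by (intro card_image_le) auto
  also have "card (R \<inter> I) \<le> card R" using fin by (intro card_mono) auto
  finally have 2: "card I2 \<le> 2 * card R" by simp
  have "card I = card I1 + card I2"
    unfolding I1_def I2_def using fin by (subst card_Un_disjoint[symmetric]) (auto intro: arg_cong[of _ _ card])
  moreover have "card I \<le> card N" using assms(1,2) by (rule card_mono)
  ultimately show ?thesis using 1 2 by simp
qed

definition edges_of :: "('a \<times> 'a) set \<Rightarrow> 'a set set" where
  "edges_of T = {{i, j} | i j. (i, j) \<in> T}"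

context ranking
begin

lemma edges_of_iff: "table T \<Longrightarrow> {i, j} \<in> edges_of T \<longleftrightarrow> (i, j) \<in> T"
  using tableD by (auto simp: edges_of_def doubleton_eq_iff)

lemma edges_of_matching:
  assumes "table T" "\<And>i j k. (i, j) \<in> T \<Longrightarrow> (i, k) \<in> T \<Longrightarrow> j = k"
    and E: "E = {(i, j). i \<in> N \<and> j \<in> A i}"
  shows "matching N A (edges_of T)"
  unfolding matching_def
proof (intro conjI ballI)
  fix e assume "e \<in> edges_of T"
  then obtain i j where e: "e = {i, j}" "(i, j) \<in> T" unfolding edges_of_def by blast
  then have "(i, j) \<in> E" "(j, i) \<in> E" using tableD table_E assms(1) by blast+
  then show "\<exists>i\<in>N. \<exists>j\<in>N. j \<in> A i \<and> i \<in> A j \<and> e = {i, j}" using e(1) E by blast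
next
  show "disjoint (edges_of T)"
    unfolding disjoint_def edges_of_def using assms(2) tableD[OF assms(1)] by blast
qed

text \<open>An improving agent has no entry in \<open>T\<close> at least as good as its new partner.
  Hence a pair of \<open>M'\<close> inside \<open>I\<close> is neither in \<open>T\<close> nor
  dominated at either end, and \<open>settled\<close> forces it to meet \<open>R\<close>.\<close>

lemma settled_k_stable:
  assumes "settled T R" "R \<subseteq> V" "3 * card R \<le> card V"
    and unique: "\<And>i j k. (i, j) \<in> T \<Longrightarrow> (i, k) \<in> T \<Longrightarrow> j = k"
    and rm: "roommates N A P" "N \<noteq> {}" and E: "E = {(i, j). i \<in> N \<and> j \<in> A i}" and V: "V = N"
    and P: "\<And>i x y. i \<in> N \<Longrightarrow> (x, y) \<in> P i \<Longrightarrow> pr i x < pr i y"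
    and c: "c > 5 / 6"
  shows "k_stable N A P (c * real (card N)) (edges_of T)"
proof -
  have t: "table T" using assms(1) by (simp add: settled_def balanced_def)
  have M: "matching N A (edges_of T)" by (rule edges_of_matching[OF t unique E])
  have "real (card {i \<in> N. better A P i (partner M' i) (partner (edges_of T) i)}) < c * real (card N)"
    if M': "matching N A M'" for M'
  proof -
    define I where "I = {i \<in> N. better A P i (partner M' i) (partner (edges_of T) i)}"
    define f where "f i = the (partner M' i)" for i
    have f: "{i, f i} \<in> M'" "better A P i (Some (f i)) (partner (edges_of T) i)" if "i \<in> I" for i
    proof -
      have b: "better A P i (partner M' i) (partner (edges_of T) i)" using that by (simp add: I_def)
      then obtain j where j: "partner M' i = Some j" by (cases "partner M' i") auto
      then have "{i, j} \<in> M'" using partner_Some[OF M'] by blast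
      then show "{i, f i} \<in> M'" "better A P i (Some (f i)) (partner (edges_of T) i)"
        using b j by (auto simp: f_def)
    qed
    have edge: "(i, f i) \<in> E \<and> f i \<in> N" if i: "i \<in> I" for i
    proof -
      obtain a b where "a \<in> N" "b \<in> N" "b \<in> A a" "a \<in> A b" "{i, f i} = {a, b}"
        using M' f(1)[OF i] unfolding matching_def by blast
      then show ?thesis using E by (auto simp: doubleton_eq_iff)
    qed
    have ff: "f j = i" if "{i, j} \<in> M'" for i j
    proof -
      have "{j, i} \<in> M'" using that insert_commute[of i j "{}"] by simp
      then have "partner M' j = Some i" using partner_Some[OF M'] by blast
      then show ?thesis by (simp add: f_def)
    qed
    have "2 * card I \<le> card N + 2 * card R"
    proof (rule card_improving)
      show "finite N" using rm(1) by (simp add: roommates_def)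
      show "I \<subseteq> N" by (auto simp: I_def)
      show "R \<subseteq> N" using assms(2) V by simp
      show "f ` I \<subseteq> N" using edge by blast
      show "f (f i) = i" if "i \<in> I" for i using ff[OF f(1)[OF that]] .
      then show "inj_on f I" by (metis inj_onI)
      show "i \<in> R \<or> f i \<in> R" if i: "i \<in> I" "f i \<in> I" for i
      proof (rule ccontr)
        assume R: "\<not> (i \<in> R \<or> f i \<in> R)"
        have worse: "\<not> ((i', j') \<in> T \<and> pr i' j' \<le> pr i' (f i'))" if i': "i' \<in> I" for i' j'
        proof
          assume j': "(i', j') \<in> T \<and> pr i' j' \<le> pr i' (f i')"
          then have "partner (edges_of T) i' = Some j'"
            using partner_Some[OF M] edges_of_iff[OF t] by blast
          then have "(f i', j') \<in> P i'" using f(2)[OF i'] by simp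
          then show False using P j' i' by (fastforce simp: I_def)
        qed
        have "\<not> dominated T j' i'" if "j' \<in> I" "i' = f j'" for i' j'
        proof
          assume "dominated T j' i'"
          then obtain z where z: "best T z j'" "pr j' z < pr j' i'" unfolding dominated_def by blast
          then have "(j', z) \<in> T" using bestD(1) tableD[OF t] by blast
          then show False using worse[OF that(1), of z] z(2) that(2) by simp
        qed
        then have "\<not> dominated T i (f i)" "\<not> dominated T (f i) i"
          using i ff[OF f(1)[OF i(1)]] by metis+
        moreover have "(i, f i) \<notin> T" using worse[OF i(1), of "f i"] by simp
        ultimately show False using assms(1) R edge[OF i(1)] unfolding settled_def by blast
      qed
    qed
    \<comment> \<open>Three times \<open>2 * card I \<le> card N + 2 * card R\<close>, together with
      \<open>3 * card R \<le> card N\<close>.\<close>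
    then have "6 * card I \<le> 5 * card N" using assms(3) V by simp
    then have "real (card I) \<le> 5 / 6 * real (card N)" by linarith
    \<comment> \<open>Strict because there are agents; for empty \<open>N\<close> the threshold
      would be 0 and no matching could be stable.\<close>
    also have "\<dots> < c * real (card N)"
      using c rm by (intro mult_strict_right_mono) (auto simp: roommates_def card_gt_0_iff)
    finally show ?thesis by (simp add: I_def)
  qed
  then show ?thesis using M unfolding k_stable_def by (meson linorder_not_le)
qed

end

section \<open>From preference relations to ranks and tables\<close>

lemma roommates_D:
  assumes "roommates N A P"
  shows "finite N" "i \<in> N \<Longrightarrow> j \<in> A i \<Longrightarrow> j \<in> N \<and> j \<noteq> i \<and> i \<in> A j"
    "i \<in> N \<Longrightarrow> trans (P i)" "i \<in> N \<Longrightarrow> irrefl (P i)" "i \<in> N \<Longrightarrow> total_on (A i) (P i)"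
    "i \<in> N \<Longrightarrow> P i \<subseteq> A i \<times> A i"
  using assms unfolding roommates_def strict_linear_order_on_def by blast+

text \<open>Counts the strictly better agents, so a first choice has rank 0 and smaller is better,
  as \<open>best\<close> expects.\<close>

definition rank :: "('a \<Rightarrow> ('a \<times> 'a) set) \<Rightarrow> 'a \<Rightarrow> 'a \<Rightarrow> nat" where
  "rank P i x = card {y. (y, x) \<in> P i}"

lemma rank_less:
  assumes rm: "roommates N A P" and i: "i \<in> N" and xy: "(x, y) \<in> P i"
  shows "rank P i x < rank P i y"
  unfolding rank_def
proof (rule psubset_card_mono)
  have "finite (A i)" using roommates_D[OF rm] i by (meson finite_subset subsetI)
  then show "finite {z. (z, y) \<in> P i}"
    by (rule rev_finite_subset) (use roommates_D(6)[OF rm i] in blast)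
  have "(x, x) \<notin> P i" using roommates_D(4)[OF rm i] by (auto dest: irreflD)
  then show "{z. (z, x) \<in> P i} \<subset> {z. (z, y) \<in> P i}"
    using xy roommates_D(3)[OF rm i] by (auto dest: transD)
qed

lemma roommates_ranking:
  assumes rm: "roommates N A P"
  shows "ranking N {(i, j). i \<in> N \<and> j \<in> A i} (rank P)"
proof
  note D = roommates_D[OF rm]
  show "finite N" by (rule D(1))
  show "{(i, j). i \<in> N \<and> j \<in> A i} \<subseteq> N \<times> N" using D(2) by blast
  show "(j, i) \<in> {(i, j). i \<in> N \<and> j \<in> A i}" if "(i, j) \<in> {(i, j). i \<in> N \<and> j \<in> A i}" for i j
    using D(2) that by blast
  show "(i, i) \<notin> {(i, j). i \<in> N \<and> j \<in> A i}" for i using D(2) by blast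
  show "j = k" if "(i, j) \<in> {(i, j). i \<in> N \<and> j \<in> A i}" "(i, k) \<in> {(i, j). i \<in> N \<and> j \<in> A i}"
    "rank P i j = rank P i k" for i j k
    using that D(5) rank_less[OF rm, of i j k] rank_less[OF rm, of i k j]
    unfolding total_on_def by fastforce
qed

definition pref_table :: "('a \<Rightarrow> 'a list) \<Rightarrow> 'a list \<Rightarrow> ('a \<times> 'a) list" where
  "pref_table l L = concat (map (\<lambda>i. map (Pair i) (l i)) L)"

lemma pref_table_ordered:
  assumes rm: "roommates N A P" and L: "distinct L" "set L \<subseteq> N"
  shows "ranking.ordered (rank P) (pref_table (pref_list A P) L)"
  unfolding ranking.ordered_def[OF roommates_ranking[OF rm]]
  using L
proof (induction L)
  case (Cons i L)
  have "sorted_wrt (\<lambda>x y. rank P i x < rank P i y) (pref_list A P i)"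
    using pref_list(2)[OF rm] rank_less[OF rm] Cons.prems(2)
    by (intro sorted_wrt_mono_rel[OF _ pref_list(2)[OF rm]]) auto
  then show ?case
    using Cons by (auto simp: pref_table_def sorted_wrt_append sorted_wrt_map)
qed (simp add: pref_table_def)

text \<open>The list computation proves existence for agents of any type as well. The second claim
  is how the program outputs the matching: rows of the final table have at most one entry, so the
  first is the partner.\<close>

lemma final_table_k_stable:
  fixes c :: real
  assumes rm: "roommates N A P" "N \<noteq> {}" and L: "distinct L" "set L = N" and c: "c > 5 / 6"
  defines "T \<equiv> final_table L (pref_table (pref_list A P) L)"
  shows "k_stable N A P (c * real (card N)) (edges_of (set T))"
    "i \<in> N \<Longrightarrow> partner (edges_of (set T)) i = first_of T i"
proof -
  define E where "E = {(i, j). i \<in> N \<and> j \<in> A i}"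
  interpret ranking N E "rank P" unfolding E_def by (rule roommates_ranking[OF rm(1)])
  let ?T = "pref_table (pref_list A P) L"
  have "set ?T = E"
    using pref_list(1)[OF rm(1)] L(2) by (auto simp: pref_table_def E_def)
  from final_table_correct[OF _ this L(2)] pref_table_ordered[OF rm(1) L(1)] L(2)
  obtain R where R: "good_table T R" "R \<subseteq> N" "3 * card R \<le> card N"
    "\<And>i j k. (i, j) \<in> set T \<Longrightarrow> (i, k) \<in> set T \<Longrightarrow> j = k"
    unfolding T_def by blast
  show "k_stable N A P (c * real (card N)) (edges_of (set T))"
    by (rule settled_k_stable[OF good_table_D(2)[OF R(1)] R(2-4) rm E_def refl rank_less[OF rm(1)] c])
  have t: "table (set T)" by (rule good_table_D(4)[OF R(1)])
  have M: "matching N A (edges_of (set T))" by (rule edges_of_matching[OF t R(4) E_def])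
  show "partner (edges_of (set T)) i = first_of T i" if "i \<in> N"
  proof (cases "first_of T i")
    case None
    then have "{i, j} \<notin> edges_of (set T)" for j using edges_of_iff[OF t] first_of_None by metis
    then show ?thesis using None by (simp add: partner_def)
  next
    case (Some j)
    then show ?thesis using first_of_in[OF Some] partner_Some[OF M] edges_of_iff[OF t] by metis
  qed
qed

subsection \<open>Running time\<close>

text \<open>Turns a result about a function on pairs into a closure rule for computed arguments, so
  that later goals are decomposed by the shape of their terms.\<close>

lemma poly_time_comp2:
  assumes "poly_time (enc_pair ea eb) ec (\<lambda>z. g (fst z) (snd z))"
    "poly_time e ea f1" "poly_time e eb f2"
  shows "poly_time e ec (\<lambda>x. g (f1 x) (f2 x))"
  using poly_time_comp[OF poly_time_pair[OF assms(2,3)] assms(1)] by simp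

lemma poly_time_comp3:
  assumes "poly_time (enc_pair ea (enc_pair eb ec)) ed (\<lambda>z. g (fst z) (fst (snd z)) (snd (snd z)))"
    "poly_time e ea f1" "poly_time e eb f2" "poly_time e ec f3"
  shows "poly_time e ed (\<lambda>x. g (f1 x) (f2 x) (f3 x))"
  using poly_time_comp[OF poly_time_pair[OF assms(2) poly_time_pair[OF assms(3,4)]] assms(1)] by simp

lemma poly_time_comp4:
  assumes "poly_time (enc_pair ea (enc_pair eb (enc_pair ec ed))) ee
      (\<lambda>z. g (fst z) (fst (snd z)) (fst (snd (snd z))) (snd (snd (snd z))))"
    "poly_time e ea f1" "poly_time e eb f2" "poly_time e ec f3" "poly_time e ed f4"
  shows "poly_time e ee (\<lambda>x. g (f1 x) (f2 x) (f3 x) (f4 x))"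
  using poly_time_comp[OF poly_time_pair[OF assms(2) poly_time_pair[OF assms(3)
        poly_time_pair[OF assms(4,5)]]] assms(1)] by simp

abbreviation enc_table :: "(nat \<times> nat) list \<Rightarrow> tree" where
  "enc_table \<equiv> enc_list (enc_pair enc_nat enc_nat)"

lemma size_fold_le:
  assumes "\<And>b s. size (e (f b s)) \<le> size (e s)" shows "size (e (fold f l s)) \<le> size (e s)"
proof (induction l arbitrary: s)
  case (Cons b l)
  show ?case using le_trans[OF Cons assms] by simp
qed simp

lemma size_filter_le: "size (enc_list e (filter P l)) \<le> size (enc_list e l)"
  by (induction l) auto

text \<open>All steps on tables only delete entries, and for a state that never grows the growth
  bound is linear.\<close>

lemma poly_time_fold_le:
  assumes "poly_time ea (enc_list eb) l" "poly_time ea es s"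
    "poly_time (enc_pair ea (enc_pair eb es)) es (\<lambda>z. f (fst z) (fst (snd z)) (snd (snd z)))"
    "\<And>x b s. size (es (f x b s)) \<le> size (es s)"
  shows "poly_time ea es (\<lambda>x. fold (f x) (l x) (s x))"
proof (rule poly_time_fold[OF assms(1-3), where r = "[:0, 1:]"])
  fix x l s show "size (es (fold (f x) l s)) \<le>
      poly [:0, 1:] (size (ea x) + size (enc_list eb l) + size (es s))"
    using size_fold_le[of es "f x", OF assms(4)] by (simp add: trans_le_add2)
qed

lemma poly_time_last_of:
  assumes "poly_time e enc_table T" "poly_time e enc_nat i"
  shows "poly_time e (enc_option enc_nat) (\<lambda>x. last_of (T x) (i x))"
proof (rule poly_time_comp2[OF _ assms])
  have s: "size (enc_option enc_nat (fold (\<lambda>e s. if fst e = i then Some (snd e) else s) T s))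
      \<le> size (enc_table T) + size (enc_option enc_nat s)" for T s and i :: nat
  proof (induction T arbitrary: s)
    case (Cons e T)
    show ?case using Cons[of s] Cons[of "Some (snd e)"] by (simp add: enc_pair_def)
  qed simp
  show "poly_time (enc_pair enc_table enc_nat) (enc_option enc_nat) (\<lambda>z. last_of (fst z) (snd z))"
    unfolding last_of_def
    by (rule poly_time_fold[where r = "[:0, 1:]"], (rule poly_time_basic poly_time_eq)+,
      rule le_trans[OF s]) simp
qed

lemma poly_time_first_of:
  assumes "poly_time e enc_table T" "poly_time e enc_nat i"
  shows "poly_time e (enc_option enc_nat) (\<lambda>x. first_of (T x) (i x))"
  unfolding first_of_def by (rule poly_time_last_of poly_time_rev assms)+

lemma size_drop_pair: "size (enc_table (drop_pair a b T)) \<le> size (enc_table T)"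
  unfolding drop_pair_def by (rule size_filter_le)

lemma poly_time_drop_pair:
  assumes "poly_time e enc_nat a" "poly_time e enc_nat b" "poly_time e enc_table T"
  shows "poly_time e enc_table (\<lambda>x. drop_pair (a x) (b x) (T x))"
proof (rule poly_time_comp3[OF _ assms])
  show "poly_time (enc_pair enc_nat (enc_pair enc_nat enc_table)) enc_table
      (\<lambda>z. drop_pair (fst z) (fst (snd z)) (snd (snd z)))"
    unfolding drop_pair_def by (rule poly_time_filter poly_time_basic poly_time_eq)+
qed

lemma size_propose: "size (enc_table (propose i T)) \<le> size (enc_table T)"
  unfolding propose_def by (simp add: size_drop_pair split: option.split)

lemma poly_time_propose:
  assumes "poly_time e enc_nat i" "poly_time e enc_table T"
  shows "poly_time e enc_table (\<lambda>x. propose (i x) (T x))"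
proof (rule poly_time_comp2[OF _ assms])
  show "poly_time (enc_pair enc_nat enc_table) enc_table (\<lambda>z. propose (fst z) (snd z))"
    unfolding propose_def
    by (rule poly_time_case poly_time_first_of poly_time_last_of poly_time_drop_pair poly_time_eq poly_time_basic)+
qed

lemma size_proposals: "size (enc_table (proposals V K T)) \<le> size (enc_table T)"
  unfolding proposals_def by (intro size_fold_le size_propose)

lemma poly_time_proposals:
  assumes "poly_time e (enc_list enc_nat) V" "poly_time e (enc_list eb) K" "poly_time e enc_table T"
  shows "poly_time e enc_table (\<lambda>x. proposals (V x) (K x) (T x))"
proof (rule poly_time_comp3[OF _ assms])
  show "poly_time (enc_pair (enc_list enc_nat) (enc_pair (enc_list eb) enc_table)) enc_table
      (\<lambda>z. proposals (fst z) (fst (snd z)) (snd (snd z)))"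
    unfolding proposals_def
    by (rule poly_time_fold_le poly_time_propose poly_time_basic size_fold_le size_propose)+
qed

lemma size_cut_first: "size (enc_table (cut_first V K x T)) \<le> size (enc_table T)"
  unfolding cut_first_def
  by (auto split: option.split intro: le_trans[OF size_proposals size_drop_pair])

lemma poly_time_cut_first:
  assumes "poly_time e (enc_list enc_nat) V" "poly_time e (enc_list eb) K" "poly_time e enc_nat x"
    "poly_time e enc_table T"
  shows "poly_time e enc_table (\<lambda>z. cut_first (V z) (K z) (x z) (T z))"
proof (rule poly_time_comp4[OF _ assms])
  show "poly_time (enc_pair (enc_list enc_nat) (enc_pair (enc_list eb) (enc_pair enc_nat enc_table)))
      enc_table (\<lambda>z. cut_first (fst z) (fst (snd z)) (fst (snd (snd z))) (snd (snd (snd z))))"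
    unfolding cut_first_def
    by (rule poly_time_case poly_time_first_of poly_time_last_of poly_time_drop_pair
        poly_time_proposals poly_time_eq poly_time_basic)+
qed

lemma size_safe_cut: "size (enc_table (safe_cut V K x T)) \<le> size (enc_table T)"
  unfolding safe_cut_def by (simp add: size_cut_first split: option.split)

lemma poly_time_safe_cut:
  assumes "poly_time e (enc_list enc_nat) V" "poly_time e (enc_list eb) K" "poly_time e enc_nat x"
    "poly_time e enc_table T"
  shows "poly_time e enc_table (\<lambda>z. safe_cut (V z) (K z) (x z) (T z))"
proof (rule poly_time_comp4[OF _ assms])
  show "poly_time (enc_pair (enc_list enc_nat) (enc_pair (enc_list eb) (enc_pair enc_nat enc_table)))
      enc_table (\<lambda>z. safe_cut (fst z) (fst (snd z)) (fst (snd (snd z))) (snd (snd (snd z))))"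
    unfolding safe_cut_def
    by (rule poly_time_case poly_time_first_of poly_time_last_of
        poly_time_cut_first poly_time_eq poly_time_basic)+
qed

lemma poly_time_final_table:
  assumes "poly_time e (enc_list enc_nat) V" "poly_time e enc_table T"
  shows "poly_time e enc_table (\<lambda>x. final_table (V x) (T x))"
proof (rule poly_time_comp2[OF _ assms])
  show "poly_time (enc_pair (enc_list enc_nat) enc_table) enc_table
      (\<lambda>z. final_table (fst z) (snd z))"
    unfolding final_table_def
    by (rule poly_time_fold_le poly_time_proposals poly_time_cut_first poly_time_safe_cut
        poly_time_basic size_fold_le size_cut_first size_safe_cut)+
qed

section \<open>Reading the instance and writing the matching\<close>

definition indices :: "nat list list \<Rightarrow> nat list" where
  "indices L = rev (snd (fold (\<lambda>_ s. (Suc (fst s), fst s # snd s)) L (0, [])))"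

definition pairs :: "nat list list \<Rightarrow> (nat \<times> nat) list" where
  "pairs L = rev (snd (fold (\<lambda>l s. (Suc (fst s), fold (\<lambda>j a. (fst s, j) # a) l (snd s))) L (0, [])))"

definition solve :: "nat list list \<Rightarrow> nat option list" where
  "solve L = map (first_of (final_table (indices L) (pairs L))) (indices L)"

lemma indices_eq: "indices L = [0..<length L]"
proof -
  have "fold (\<lambda>_ s. (Suc (fst s), fst s # snd s)) L (k, a) = (k + length L, rev [k..<k + length L] @ a)" for k a
  proof (induction L arbitrary: k a)
    case (Cons l L)
    have "[k..<k + length (l # L)] = k # [Suc k..<Suc k + length L]"
      by (simp add: upt_rec)
    then show ?case by (simp add: Cons)
  qed simp
  then show ?thesis by (simp add: indices_def)
qed

lemma pairs_eq: "pairs (map l [0..<n]) = pref_table l [0..<n]"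
proof -
  have row: "fold (\<lambda>j a. (k, j) # a) xs a = rev (map (Pair k) xs) @ a" for k :: nat and xs :: "nat list" and a
    by (induction xs arbitrary: a) auto
  have "fold (\<lambda>l s. (Suc (fst s), fold (\<lambda>j a. (fst s, j) # a) l (snd s))) (map l [0..<n]) (0, [])
      = (n, rev (pref_table l [0..<n]))"
    by (induction n) (simp_all add: row pref_table_def)
  then show ?thesis by (simp add: pairs_def)
qed

lemma poly_time_indices: "poly_time (enc_list eb) (enc_list enc_nat) (\<lambda>L. indices L)"
proof -
  let ?f = "\<lambda>_ s. (Suc (fst s), fst s # snd s)"
  have s: "size (enc_pair enc_nat (enc_list enc_nat) (fold ?f L (k, a)))
      \<le> 1 + k + size (enc_list enc_nat a) + length L * (k + length L + 2)" for L :: "'a list" and k a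
  proof (induction L arbitrary: k a)
    case (Cons l L)
    show ?case using Cons[of "Suc k" "k # a"] by (simp add: size_enc_nat algebra_simps)
  qed (simp add: enc_pair_def size_enc_nat)
  have "poly_time (enc_list eb) (enc_pair enc_nat (enc_list enc_nat)) (\<lambda>L. fold ?f L (0, []))"
  \<comment> \<open>This is \<open>1 + N + N * (2 + 2 * N)\<close>: the initial state, then at most
    \<open>N\<close> rounds, each adding an index below \<open>k + length L\<close> with its
    overhead.\<close>
  proof (rule poly_time_fold[where r = "[:1, 1:] + [:0, 1:] * [:2, 2:]"])
    fix x L s
    let ?N = "size (enc_list eb x) + size (enc_list eb L) + size (enc_pair enc_nat (enc_list enc_nat) s)"
    obtain k a where s': "s = (k, a)" by (cases s)
    have "length L \<le> ?N" using length_le_size_enc_list[of L eb] by simp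
    moreover from this have "k + length L + 2 \<le> 2 + 2 * ?N" by (simp add: s' enc_pair_def size_enc_nat)
    ultimately have "length L * (k + length L + 2) \<le> ?N * (2 + 2 * ?N)" by (rule mult_le_mono)
    then show "size (enc_pair enc_nat (enc_list enc_nat) (fold ?f L s)) \<le> poly ([:1, 1:] + [:0, 1:] * [:2, 2:]) ?N"
      using s[of L k a] by (simp add: s' enc_pair_def size_enc_nat algebra_simps)
  qed (rule poly_time_pair poly_time_basic)+
  then show ?thesis unfolding indices_def by - (rule poly_time_rev poly_time_snd | assumption)+
qed

lemma size_row:
  "size (enc_table (fold (\<lambda>j a. (k, j) # a) l a)) =
     size (enc_table a) + size (enc_list enc_nat l) + length l * (k + 1)"
  by (induction l arbitrary: a) (simp_all add: enc_pair_def size_enc_nat)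

lemma poly_time_pairs: "poly_time (enc_list (enc_list enc_nat)) enc_table (\<lambda>L. pairs L)"
proof -
  let ?f = "\<lambda>l s. (Suc (fst s), fold (\<lambda>j a. (fst s, j) # a) l (snd s))"
  let ?e = "enc_pair enc_nat enc_table" and ?eL = "enc_list (enc_list enc_nat)"
  have s: "size (?e (fold ?f L (k, a)))
      \<le> 1 + k + length L + size (enc_table a) + size (?eL L) + size (?eL L) * (k + length L + 1)" for L k a
  proof (induction L arbitrary: k a)
    case (Cons l L)
    have "length l * (k + 1) \<le> size (enc_list enc_nat l) * (k + length L + 2)"
      by (rule mult_le_mono) (simp_all add: length_le_size_enc_list)
    then show ?case
      using Cons[of "Suc k" "fold (\<lambda>j a. (k, j) # a) l a"] by (simp add: size_row algebra_simps)
  qed (simp add: enc_pair_def size_enc_nat)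
  have inner: "poly_time (enc_pair ?eL (enc_pair (enc_list enc_nat) ?e)) enc_table
      (\<lambda>z. fold (\<lambda>j a. (fst (snd (snd z)), j) # a) (fst (snd z)) (snd (snd (snd z))))"
  proof (rule poly_time_fold[where r = "[:0, 1:] + [:0, 1:] * [:1, 1:]"])
    fix x :: "nat list list \<times> nat list \<times> nat \<times> (nat \<times> nat) list" and l a
    let ?N = "size (enc_pair ?eL (enc_pair (enc_list enc_nat) ?e) x) + size (enc_list enc_nat l) + size (enc_table a)"
    have "length l * (fst (snd (snd x)) + 1) \<le> ?N * (1 + ?N)"
    proof (rule mult_le_mono)
      show "length l \<le> ?N" using length_le_size_enc_list[of l enc_nat] by simp
      show "fst (snd (snd x)) + 1 \<le> 1 + ?N" by (simp add: enc_pair_def size_enc_nat)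
    qed
    then show "size (enc_table (fold (\<lambda>j a. (fst (snd (snd x)), j) # a) l a)) \<le> poly ([:0, 1:] + [:0, 1:] * [:1, 1:]) ?N"
      unfolding size_row by (simp add: algebra_simps)
  qed (rule poly_time_pair poly_time_basic)+
  have "poly_time ?eL ?e (\<lambda>L. fold ?f L (0, []))"
  proof (rule poly_time_fold[where r = "[:1, 3:] + [:0, 1:] * [:1, 2:]"])
    show "poly_time (enc_pair ?eL (enc_pair (enc_list enc_nat) ?e)) ?e
        (\<lambda>z. (Suc (fst (snd (snd z))), fold (\<lambda>j a. (fst (snd (snd z)), j) # a) (fst (snd z)) (snd (snd (snd z)))))"
      by (rule poly_time_pair inner poly_time_basic)+
    fix x L s
    let ?N = "size (?eL x) + size (?eL L) + size (?e s)"
    obtain k a where s': "s = (k, a)" by (cases s)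
    have len: "length L \<le> size (?eL L)" by (rule length_le_size_enc_list)
    have "size (?eL L) * (k + length L + 1) \<le> ?N * (1 + 2 * ?N)"
      by (rule mult_le_mono) (use len in \<open>simp_all add: s' enc_pair_def size_enc_nat\<close>)
    then show "size (?e (fold ?f L s)) \<le> poly ([:1, 3:] + [:0, 1:] * [:1, 2:]) ?N"
      using s[of L k a] len by (simp add: s' enc_pair_def size_enc_nat algebra_simps)
  qed (rule poly_time_pair poly_time_basic)+
  then show ?thesis unfolding pairs_def by - (rule poly_time_rev poly_time_snd | assumption)+
qed

lemma poly_time_solve: "poly_time (enc_list (enc_list enc_nat)) (enc_list (enc_option enc_nat)) (\<lambda>L. solve L)"
proof -
  let ?e = "enc_list (enc_list enc_nat)"
  have "poly_time (enc_pair ?e enc_nat) enc_table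
      (\<lambda>z. final_table (indices (fst z)) (pairs (fst z)))"
    by (rule poly_time_final_table, rule poly_time_comp[OF poly_time_fst[OF poly_time_id] poly_time_indices],
        rule poly_time_comp[OF poly_time_fst[OF poly_time_id] poly_time_pairs])
  then show ?thesis
    unfolding solve_def
    by - (rule poly_time_map[OF poly_time_indices], rule poly_time_first_of, assumption, rule poly_time_snd, rule poly_time_id)
qed

lemma poly_time_computes_within:
  assumes "poly_time ea eb f"
  obtains p q where "\<And>x. computes_within p (ea x) (poly q (size (ea x))) (eb (f x))"
proof -
  obtain p m q where "implements p m q ea eb f" using assms unfolding poly_time_def by blast
  then have "reach p ((\<lambda>_. Leaf)(0 := ea x)) (poly q (size (ea x))) (\<lambda>s. s 0 = eb (f x))" for x
    by (rule implements_run[where x = x]) simp_all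
  then show ?thesis using that unfolding reach_def computes_within_def by blast
qed

lemma size_enc_list_le: "(\<And>x. x \<in> set xs \<Longrightarrow> size (e x) \<le> B) \<Longrightarrow> size (enc_list e xs) \<le> length xs * (B + 1)"
proof (induction xs)
  case (Cons a xs)
  then have "size (enc_list e xs) \<le> length xs * (B + 1)" "size (e a) \<le> B" by simp_all
  then show ?case by simp
qed simp

text \<open>Preference lists are free of repetitions by irreflexivity, so there are \<open>n\<close>
  lists of at most \<open>n\<close> agents, each costing at most \<open>n\<close> in unary plus one
  cell. This turns time bounds in the size of the input tree into bounds in
  \<open>n\<close>.\<close>

lemma size_enc_instance:
  assumes rm: "roommates {..<n} A P" shows "size (enc_instance n A P) \<le> n * (n * (n + 1) + 1)"
proof -
  have "size (enc_list enc_nat (pref_list A P i)) \<le> n * (n + 1)" if i: "i < n" for i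
  proof -
    let ?l = "pref_list A P i"
    have i': "i \<in> {..<n}" using i by simp
    have l: "set ?l \<subseteq> {..<n}" using pref_list(1)[OF rm i'] roommates_D(2)[OF rm i'] by blast
    have "sorted_wrt (\<noteq>) ?l"
      by (rule sorted_wrt_mono_rel[OF _ pref_list(2)[OF rm i']])
        (use roommates_D(4)[OF rm i'] in \<open>auto dest: irreflD\<close>)
    moreover have "distinct xs" if "sorted_wrt (\<noteq>) xs" for xs :: "nat list"
      using that by (induction xs) auto
    ultimately have "distinct ?l" by blast
    then have "length ?l \<le> n" using card_mono[OF _ l] by (simp add: distinct_card)
    moreover have "size (enc_list enc_nat ?l) \<le> length ?l * (n + 1)"
      by (rule size_enc_list_le) (use l in \<open>auto simp: size_enc_nat\<close>)
    ultimately show ?thesis by (meson le_trans mult_le_mono1)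
  qed
  then have "size (enc_instance n A P) \<le> length (map (pref_list A P) [0..<n]) * (n * (n + 1) + 1)"
    unfolding enc_instance_def by (intro size_enc_list_le) auto
  then show ?thesis by simp
qed

theorem theorem9:
  fixes c :: real
  assumes "c > 5 / 6"
  shows "(\<forall>(N :: 'a set) A P. roommates N A P \<and> N \<noteq> {} \<longrightarrow>
            (\<exists>M. k_stable N A P (c * real (card N)) M))
       \<and> (\<exists>(p :: prog) (T :: nat poly). \<forall>n A P. roommates {..<n} A P \<and> n > 0 \<longrightarrow>
            (\<exists>M. k_stable {..<n} A P (c * real n) M \<and>
                 computes_within p (enc_instance n A P) (poly T n) (enc_matching n M)))"
proof (intro conjI allI impI)
  fix N :: "'a set" and A P
  assume rm: "roommates N A P \<and> N \<noteq> {}"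
  then obtain L where "distinct L" "set L = N"
    using finite_distinct_list roommates_D(1) by metis
  then show "\<exists>M. k_stable N A P (c * real (card N)) M"
    using final_table_k_stable(1) rm assms by blast
next
  obtain p q where pq: "\<And>L. computes_within p (enc_list (enc_list enc_nat) L)
      (poly q (size (enc_list (enc_list enc_nat) L))) (enc_list (enc_option enc_nat) (solve L))"
    using poly_time_computes_within[OF poly_time_solve] by blast
  let ?T = "pcompose q ([:0, 1:] * ([:0, 1:] * [:1, 1:] + 1))"
  have "\<exists>M. k_stable {..<n} A P (c * real n) M \<and>
      computes_within p (enc_instance n A P) (poly ?T n) (enc_matching n M)"
    if rm: "roommates {..<n} A P" and n: "n > 0" for n A P
  proof (intro exI conjI)
    let ?l = "pref_list A P" and ?L = "[0..<n]"
    let ?M = "edges_of (set (final_table ?L (pref_table ?l ?L)))"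
    have ne: "{..<n} \<noteq> {}" and L: "distinct ?L" "set ?L = {..<n}" using n by auto
    note K = final_table_k_stable[OF rm ne L assms]
    show "k_stable {..<n} A P (c * real n) ?M" using K(1) by simp
    have "solve (map ?l ?L) = map (partner ?M) ?L"
      unfolding solve_def indices_eq pairs_eq using K(2) by simp
    then have out: "enc_list (enc_option enc_nat) (solve (map ?l ?L)) = enc_matching n ?M"
      by (simp add: enc_matching_def)
    have "poly q (size (enc_instance n A P)) \<le> poly ?T n"
      using poly_mono_nat[OF size_enc_instance[OF rm], of q] by (simp add: poly_pcompose algebra_simps)
    then show "computes_within p (enc_instance n A P) (poly ?T n) (enc_matching n ?M)"
      using pq[of "map ?l ?L"] unfolding out computes_within_def enc_instance_def by (meson le_trans)
  qed
  then show "\<exists>(p :: prog) (T :: nat poly). \<forall>n A P. roommates {..<n} A P \<and> n > 0 \<longrightarrow>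
            (\<exists>M. k_stable {..<n} A P (c * real n) M \<and>
                 computes_within p (enc_instance n A P) (poly T n) (enc_matching n M))"
    by blast
qed

end
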